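(* For each triplet $M,M',\widetilde M$ of simple singularities listed in the context (a corank 3 simple symmetric matrix family in four variables, an odd function on $\mathbb C^2$, and a centrally symmetric complete intersection curve in $\mathbb C^3$), the pairs consisting of the base of a corresponding miniversal deformation and the bifurcation diagram of the singularity are biholomorphic: $$(\Lambda,\Sigma)\simeq(\Lambda',\Sigma')\simeq(\widetilde\Lambda,\widetilde\Sigma).$$
   Context: The triplets. The matrix families are $M:(\mathbb C^4_{x,y,z,w},0)\to\mathrm{Sym}_3$ (complex symmetric $3\times3$ matrices), with $\mathrm{SL}$-miniversal deformations $M_\lambda$, $\lambda\in\Lambda=\mathbb C^\tau$ ($\lambda=0$ giving $M$; $\tau$ is the subscript in the name): - $\mathrm I_{k+1}$, $k\ge1$: $M_\lambda=\begin{pmatrix}x&\lambda_k&z\\ \lambda_k&y+P(x)&w\\ z&w&y\end{pmatrix}$, $P(x)=x^k+\lambda_{k-1}x^{k-1}+\dots+\lambda_1x+\lambda_0$; $M'=ac^2+a^{2k+1}$; $\widetilde M=\{c^2+2bc+a^{2k}=0,\ ab=0\}$. - $\mathrm{II}_\tau$: $M_\lambda=\begin{pmatrix}x&p(w)&y+q(w)\\ p(w)&y&z\\ y+q(w)&z&w\end{pmatrix}$, where for $\mathrm{II}_4$: $p=w^2+\lambda_1w+\lambda_0$, $q=\lambda_3w+\lambda_2$; $M'=b^3+c^5$; $\widetilde M=\{b^2-ac=0,\ ab-c^4=0\}$; for $\mathrm{II}_5$: $p=\lambda_2w^2+\lambda_1w+\lambda_0$, $q=w^2+\lambda_4w+\lambda_3$;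 $M'=b^3-bc^4$; $\widetilde M=\{b^2-ac+c^4=0,\ ab=0\}$; for $\mathrm{II}_6$: $p=w^3+\lambda_2w^2+\lambda_1w+\lambda_0$, $q=\lambda_5w^2+\lambda_4w+\lambda_3$; $M'=b^3+c^7$; $\widetilde M=\{b^2-ac=0,\ ab-c^6=0\}$. ($\mathrm{SL}$-miniversality is with respect to the equivalence $M_1\circ\varphi=A^\top M_2A$, $\varphi$ a biholomorphism of the source and $A$ a holomorphic $\mathrm{SL}_3(\mathbb C)$-valued map.) Bifurcation diagrams. - Matrices: $\Delta\subset\mathrm{Sym}_3$, the set of degenerate matrices, is stratified by the sets $\Delta_c$ of matrices of corank $c$, $c=1,2,3$. $\Sigma\subset\Lambda$ is the set of all $\lambda$ for which $M_\lambda$ is (locally) not transversal to this stratification. - Odd functions: $\mathcal R_{odd,2}$ is the group of biholomorphism germs of $(\mathbb C^2,0)$ commuting with $-\mathrm{id}$. $\Lambda'$ is the base of an $\mathcal R_{odd,2}$-miniversal deformation of $M'$ within odd functions (obtained from a monomial $\mathcal R$-miniversal deformation by omitting all even monomials). $\Sigma'\subset\Lambda'$ is the set of all base points for which the zero level of the corresponding function is not smooth. - Curves: $\mathcal K_{odd,3}$ is the subgroup of the contact group $\mathcal K$ in which the coordinate changes of $(\mathbb C^3,0)$ are restricted to those commuting with the central symmetry $(a,b,c)\mapsto(-a,-b,-c)$. $\widetilde\Lambda$ is the base of a $\mathcal K_{odd,3}$-miniversal deformation of the curve $\widetilde M$ in the class of centrally symmetric complete intersections (obtained from a monomial $\mathcal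 K$-miniversal deformation by omitting all odd monomials). Explicitly, such miniversal deformations are $\{2bc+c^2+P(a^2)=0,\ ab-\lambda_k=0\}$ for the curve corresponding to $\mathrm I_{k+1}$, and $\{-ac+b^2+q(c^2)=0,\ ab-p(c^2)=0\}$ for the curves corresponding to $\mathrm{II}_\tau$. $\widetilde\Sigma\subset\widetilde\Lambda$ is the set of all base points corresponding to singular curves. All singularities and deformations here are quasi-homogeneous, so all objects are considered globally on complex coordinate spaces. *)

theory Defs
  imports "HOL-Analysis.Analysis"
begin

text \<open>Several complex variables on the coordinate spaces \<^typ>\<open>complex^'n\<close>: complex
  differentiability is real Frechet differentiability with a complex-linear derivative.\<close>

definition complex_diff_at :: "(complex^'n \<Rightarrow> complex) \<Rightarrow> complex^'n \<Rightarrow> bool" where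
  "complex_diff_at f x \<longleftrightarrow>
     (\<exists>D. (f has_derivative D) (at x) \<and> (\<forall>c v. D (c *s v) = c * D v))"

definition holomorphic_map :: "(complex^'n \<Rightarrow> complex^'m) \<Rightarrow> bool" where
  "holomorphic_map f \<longleftrightarrow> (\<forall>x i. complex_diff_at (\<lambda>y. f y $ i) x)"

definition biholomorphism :: "(complex^'n \<Rightarrow> complex^'m) \<Rightarrow> bool" where
  "biholomorphism f \<longleftrightarrow> bij f \<and> holomorphic_map f \<and> holomorphic_map (inv f)"

definition biholomorphic_pairs :: "(complex^'n) set \<Rightarrow> (complex^'m) set \<Rightarrow> bool" where
  "biholomorphic_pairs S T \<longleftrightarrow> (\<exists>f. biholomorphism f \<and> f ` S = T)"

definition holomorphic_germ :: "(complex^'n \<Rightarrow> complex) \<Rightarrow> bool" where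
  "holomorphic_germ g \<longleftrightarrow> (\<forall>\<^sub>F x in nhds 0. complex_diff_at g x)"

text \<open>The zero level of \<open>G\<close> is smooth as a hypersurface or complete intersection:
  \<open>0\<close> is a regular value. The Frechet derivative of a holomorphic map is its complex
  differential.\<close>

definition smooth_zero_level ::
    "('a::real_normed_vector \<Rightarrow> 'b::real_normed_vector) \<Rightarrow> bool" where
  "smooth_zero_level G \<longleftrightarrow> (\<forall>u. G u = 0 \<longrightarrow> surj (frechet_derivative G (at u)))"

text \<open>The stratification of degenerate symmetric matrices by corank, and transversality.\<close>

definition Sym3 :: "(complex^3^3) set" where
  "Sym3 = {A. transpose A = A}"

definition corank :: "complex^3^3 \<Rightarrow> nat" where
  "corank A = 3 - rank A"

definition corank_stratum :: "nat \<Rightarrow> (complex^3^3) set" where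
  "corank_stratum c = {A \<in> Sym3. corank A = c}"

text \<open>The tangent space at \<open>A\<close> of a complex submanifold \<open>S\<close>: the velocities of the
  holomorphic curve germs in \<open>S\<close> through \<open>A\<close>.\<close>

definition tangent_space :: "(complex^3^3) set \<Rightarrow> complex^3^3 \<Rightarrow> (complex^3^3) set" where
  "tangent_space S A =
     {V. \<exists>\<gamma> :: complex \<Rightarrow> complex^3^3.
           \<gamma> 0 = A \<and> (\<forall>\<^sub>F t in nhds 0. \<gamma> t \<in> S) \<and>
           (\<forall>i j. (\<lambda>t. \<gamma> t $ i $ j) analytic_on {0} \<and> deriv (\<lambda>t. \<gamma> t $ i $ j) 0 = V $ i $ j)}"

definition transversal_to_coranks :: "(complex^4 \<Rightarrow> complex^3^3) \<Rightarrow> bool" where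
  "transversal_to_coranks M \<longleftrightarrow>
     (\<forall>v. \<forall>c\<in>{1,2,3}. M v \<in> corank_stratum c \<longrightarrow>
        {X + Y | X Y. X \<in> range (frechet_derivative M (at v)) \<and>
                      Y \<in> tangent_space (corank_stratum c) (M v)} = Sym3)"

text \<open>The list of triplets: \<open>Type_I k\<close> stands for \<open>I\<^bsub>k+1\<^esub>\<close>. In the families
  below, \<open>l i\<close> is the parameter \<open>\<lambda>\<^sub>i\<close> for \<open>i < tau T\<close>.\<close>

datatype type_II = II4 | II5 | II6

datatype triplet = Type_I nat | Type_II type_II

fun tau :: "triplet \<Rightarrow> nat" where
  "tau (Type_I k) = k + 1"
| "tau (Type_II II4) = 4"
| "tau (Type_II II5) = 5"
| "tau (Type_II II6) = 6"

definition P_I :: "nat \<Rightarrow> (nat \<Rightarrow> complex) \<Rightarrow> complex \<Rightarrow> complex" where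
  "P_I k l x = x ^ k + (\<Sum>i<k. l i * x ^ i)"

fun p_II :: "type_II \<Rightarrow> (nat \<Rightarrow> complex) \<Rightarrow> complex \<Rightarrow> complex" where
  "p_II II4 l w = w^2 + l 1 * w + l 0"
| "p_II II5 l w = l 2 * w^2 + l 1 * w + l 0"
| "p_II II6 l w = w^3 + l 2 * w^2 + l 1 * w + l 0"

fun q_II :: "type_II \<Rightarrow> (nat \<Rightarrow> complex) \<Rightarrow> complex \<Rightarrow> complex" where
  "q_II II4 l w = l 3 * w + l 2"
| "q_II II5 l w = w^2 + l 4 * w + l 3"
| "q_II II6 l w = l 5 * w^2 + l 4 * w + l 3"

text \<open>The matrix families; the argument is \<open>(x, y, z, w)\<close>.\<close>

fun matrix_family :: "triplet \<Rightarrow> (nat \<Rightarrow> complex) \<Rightarrow> complex^4 \<Rightarrow> complex^3^3" where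
  "matrix_family (Type_I k) l v =
     (let x = v $ 1; y = v $ 2; z = v $ 3; w = v $ 4 in
      vector [vector [x,   l k,           z],
              vector [l k, y + P_I k l x, w],
              vector [z,   w,             y]])"
| "matrix_family (Type_II s) l v =
     (let x = v $ 1; y = v $ 2; z = v $ 3; w = v $ 4 in
      vector [vector [x,               p_II s l w, y + q_II s l w],
              vector [p_II s l w,      y,          z],
              vector [y + q_II s l w,  z,          w]])"

text \<open>The odd functions \<open>M'\<close>; the argument is \<open>(a, c)\<close> for type I and \<open>(b, c)\<close> for type II.\<close>

fun odd_function :: "triplet \<Rightarrow> complex^2 \<Rightarrow> complex" where
  "odd_function (Type_I k) u = (let a = u $ 1; c = u $ 2 in a * c^2 + a ^ (2 * k + 1))"
| "odd_function (Type_II II4) u = (let b = u $ 1; c = u $ 2 in b^3 + c^5)"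
| "odd_function (Type_II II5) u = (let b = u $ 1; c = u $ 2 in b^3 - b * c^4)"
| "odd_function (Type_II II6) u = (let b = u $ 1; c = u $ 2 in b^3 + c^7)"

text \<open>The deformations of the curves; the argument is \<open>(a, b, c)\<close>.\<close>

fun curve_family :: "triplet \<Rightarrow> (nat \<Rightarrow> complex) \<Rightarrow> complex^3 \<Rightarrow> complex^2" where
  "curve_family (Type_I k) l u =
     (let a = u $ 1; b = u $ 2; c = u $ 3 in
      vector [2 * b * c + c^2 + P_I k l (a^2), a * b - l k])"
| "curve_family (Type_II s) l u =
     (let a = u $ 1; b = u $ 2; c = u $ 3 in
      vector [- a * c + b^2 + q_II s l (c^2), a * b - p_II s l (c^2)])"

text \<open>A pair of exponents encodes a monomial in two variables. The deformation
  \<open>f + (\<Sum>m\<in>B. \<mu>\<^sub>m * monom2 m)\<close> is a monomial miniversal deformation of \<open>f\<close> for right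
  equivalence when the monomials in \<open>B\<close> form a basis of the local algebra of \<open>f\<close>, the
  quotient of the ring of holomorphic germs by the ideal of the first partial derivatives.\<close>

definition monom2 :: "nat \<times> nat \<Rightarrow> complex^2 \<Rightarrow> complex" where
  "monom2 m u = (u $ 1) ^ fst m * (u $ 2) ^ snd m"

definition partial_deriv :: "2 \<Rightarrow> (complex^2 \<Rightarrow> complex) \<Rightarrow> complex^2 \<Rightarrow> complex" where
  "partial_deriv i f u = frechet_derivative f (at u) (axis i 1)"

definition in_jacobian_ideal :: "(complex^2 \<Rightarrow> complex) \<Rightarrow> (complex^2 \<Rightarrow> complex) \<Rightarrow> bool" where
  "in_jacobian_ideal f g \<longleftrightarrow>
     (\<exists>\<xi> \<eta>. holomorphic_germ \<xi> \<and> holomorphic_germ \<eta> \<and>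
        (\<forall>\<^sub>F u in nhds 0. g u = \<xi> u * partial_deriv 1 f u + \<eta> u * partial_deriv 2 f u))"

definition monomial_R_miniversal :: "(complex^2 \<Rightarrow> complex) \<Rightarrow> (nat \<times> nat) set \<Rightarrow> bool" where
  "monomial_R_miniversal f B \<longleftrightarrow>
     finite B \<and>
     (\<forall>g. holomorphic_germ g \<longrightarrow>
        (\<exists>\<mu>. in_jacobian_ideal f (\<lambda>u. g u - (\<Sum>m\<in>B. \<mu> m * monom2 m u)))) \<and>
     (\<forall>\<mu>. in_jacobian_ideal f (\<lambda>u. \<Sum>m\<in>B. \<mu> m * monom2 m u) \<longrightarrow> (\<forall>m\<in>B. \<mu> m = 0))"

definition odd_monomials :: "(nat \<times> nat) set \<Rightarrow> (nat \<times> nat) set" where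
  "odd_monomials B = {m \<in> B. odd (fst m + snd m)}"

text \<open>The bifurcation diagrams. The bases are coordinate spaces: \<open>idx\<close> labels the
  coordinates \<open>\<lambda>\<^sub>0, \<lambda>\<^sub>1, \<dots>\<close> of the bases for matrices and curves by a finite index type, and
  \<open>mon\<close> labels the coordinates of the base for odd functions by the odd monomials.\<close>

definition matrix_bifurcation :: "triplet \<Rightarrow> (nat \<Rightarrow> 'n::finite) \<Rightarrow> (complex^'n) set" where
  "matrix_bifurcation T idx =
     {l. \<not> transversal_to_coranks (matrix_family T (\<lambda>i. l $ idx i))}"

definition odd_bifurcation :: "triplet \<Rightarrow> ('m::finite \<Rightarrow> nat \<times> nat) \<Rightarrow> (complex^'m) set" where
  "odd_bifurcation T mon =
     {\<mu>. \<not> smooth_zero_level (\<lambda>u. odd_function T u + (\<Sum>j\<in>UNIV. \<mu> $ j * monom2 (mon j) u))}"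

definition curve_bifurcation :: "triplet \<Rightarrow> (nat \<Rightarrow> 'n::finite) \<Rightarrow> (complex^'n) set" where
  "curve_bifurcation T idx =
     {l. \<not> smooth_zero_level (curve_family T (\<lambda>i. l $ idx i))}"

end

theory Submission
  imports Defs "HOL-Computational_Algebra.Polynomial"
begin

text \<open>The three bifurcation diagrams are compared through one geometric fact: a complex symmetric
$3 \times 3$ matrix of rank at most one has the form $u u^T$ with $u \in \mathbb C^3$, and
$u$ is determined up to sign.

The image of each family $M_\lambda$ in the six-dimensional space of
symmetric matrices is the common zero set of two functions $g_1, g_2$. For type II these are
$A_{12} - p(A_{33})$ and $A_{13} - A_{22} - q(A_{33})$, and the curve of the triplet is exactly
$\{u : g(u u^T) = 0\}$. For type I the same holds with the third coordinate $c$ of the curve replaced by $b + c$. So the curve is the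
double cover, under $u \mapsto \pm u$, of the set of points where $M_\lambda$ has corank at least two.
Transversality fails at $A = M_\lambda(v)$ exactly when some nonzero symmetric $Q$ with $A Q = 0$ is
orthogonal, for the trace form, to the image of $dM_\lambda$; the matrices orthogonal to that image
are the combinations $Q = r_1 dg_1 + r_2 dg_2$. None of them has rank one, so corank one points never
violate transversality, and $A Q = 0$ forces $A = u u^T$ with $Q u = 0$. But $2 Q u$ is the same
combination of the gradients of $g_1(u u^T)$ and $g_2(u u^T)$, hence $Q u = 0$ says that the curve is
singular at $u$. So both diagrams coincide as subsets of the same coordinate space. The
transversality criterion is \<open>not_transversal_iff\<close>; the comparison is made in
\<open>matrix_I_transversal_iff_curve_I_smooth\<close> and \<open>matrix_II_transversal_iff_curve_II_smooth\<close>.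

Eliminating $b$ (type I) or $a$ (type II) from the equations of the
curve gives the plane curves $a c^2 + a P(a^2) + 2 \lambda_k c = 0$ and
$b^3 + b q(c^2) - c p(c^2) = 0$. They are singular for the same parameters as the space curves,
although the elimination divides by $a$ or $c$: where this coordinate vanishes, the two conditions
are compared by hand
(\<open>odd_I_smooth_iff_curve_I_smooth\<close>, \<open>odd_II_smooth_iff_curve_II_smooth\<close>). Up to a linear change of
$(b, c)$ these functions are the odd deformation of $M'$, and the parameters correspond by
an explicit polynomial automorphism.

The base of the odd deformation is labelled by the odd monomials of an arbitrary monomial basis
of the local algebra. These are unique except for the curve $b^3 - b c^4$, where either $c^5$ or
$b^2 c$ occurs because $c^5 = 3 b^2 c$ in the local algebra; in the second case the linear change of
$(b, c)$ is a shear that depends on $\lambda_2$, which makes the correspondence of parameters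
nonlinear. Monomials are excluded from the basis by writing them explicitly in the Jacobian ideal,
and forced into it by restricting a hypothetical expansion to curves $(\alpha t^p, \beta t^q)$
along which the Jacobian ideal vanishes to high order (\<open>basis_monomial_detected\<close>).\<close>

section \<open>Complex differentiability on coordinate spaces\<close>

lemma has_derivative_vec_componentwise:
  fixes f :: "'a::real_normed_vector \<Rightarrow> 'b::euclidean_space^'n"
  assumes "\<And>i. ((\<lambda>x. f x $ i) has_derivative (\<lambda>h. f' h $ i)) F"
  shows "(f has_derivative f') F"
proof -
  have eq: "v = (\<Sum>i\<in>UNIV. axis i (v $ i))" for v :: "'b^'n"
    by (simp add: vec_eq_iff axis_def if_distrib cong: if_cong)
  have lin: "bounded_linear (axis i :: 'b \<Rightarrow> 'b^'n)" for i
    by (rule linear_conv_bounded_linear[THEN iffD1], rule linearI) (auto simp: vec_eq_iff axis_def)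
  have "((\<lambda>x. \<Sum>i\<in>UNIV. axis i (f x $ i)) has_derivative (\<lambda>h. \<Sum>i\<in>UNIV. axis i (f' h $ i))) F"
    by (intro has_derivative_sum bounded_linear.has_derivative[OF lin] assms)
  then show ?thesis
    by (subst (asm) (1 2) eq[symmetric])
qed

lemma has_derivative_coordinate [derivative_intros]:
  "((\<lambda>u. u $ i) has_derivative (\<lambda>h. h $ i)) F"
  by (rule bounded_linear_imp_has_derivative[OF bounded_linear_vec_nth])

lemma complex_diff_at_const: "complex_diff_at (\<lambda>_. k) x"
  unfolding complex_diff_at_def by (rule exI[of _ "\<lambda>_. 0"]) auto

lemma complex_diff_at_nth: "complex_diff_at (\<lambda>u. u $ i) x"
  unfolding complex_diff_at_def
  by (rule exI[of _ "\<lambda>h. h $ i"]) (auto intro!: bounded_linear_imp_has_derivative)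

lemma complex_diff_at_add:
  assumes "complex_diff_at f x" "complex_diff_at g x"
  shows "complex_diff_at (\<lambda>u. f u + g u) x"
proof -
  from assms obtain D E where "(f has_derivative D) (at x)" "\<forall>c v. D (c *s v) = c * D v"
    "(g has_derivative E) (at x)" "\<forall>c v. E (c *s v) = c * E v"
    unfolding complex_diff_at_def by blast
  then show ?thesis
    unfolding complex_diff_at_def
    by (intro exI[of _ "\<lambda>h. D h + E h"]) (auto intro!: has_derivative_add simp: distrib_left)
qed

lemma complex_diff_at_mult:
  assumes "complex_diff_at f x" "complex_diff_at g x"
  shows "complex_diff_at (\<lambda>u. f u * g u) x"
proof -
  from assms obtain D E where "(f has_derivative D) (at x)" "\<forall>c v. D (c *s v) = c * D v"
    "(g has_derivative E) (at x)" "\<forall>c v. E (c *s v) = c * E v"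
    unfolding complex_diff_at_def by blast
  moreover from this have "((\<lambda>u. f u * g u) has_derivative (\<lambda>h. f x * E h + D h * g x)) (at x)"
    by (intro has_derivative_mult)
  ultimately show ?thesis
    unfolding complex_diff_at_def
    by (intro exI[of _ "\<lambda>h. f x * E h + D h * g x"]) (simp add: algebra_simps)
qed

lemma complex_diff_at_minus:
  "complex_diff_at f x \<Longrightarrow> complex_diff_at (\<lambda>u. - f u) x"
  using complex_diff_at_mult[OF complex_diff_at_const[of "-1"]] by simp

lemma complex_diff_at_diff:
  "complex_diff_at f x \<Longrightarrow> complex_diff_at g x \<Longrightarrow> complex_diff_at (\<lambda>u. f u - g u) x"
  using complex_diff_at_add[OF _ complex_diff_at_minus[of g]] by simp

lemma complex_diff_at_power:
  "complex_diff_at f x \<Longrightarrow> complex_diff_at (\<lambda>u. f u ^ n) x"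
  by (induction n) (auto intro: complex_diff_at_const complex_diff_at_mult)

lemma complex_diff_at_divide_const:
  "complex_diff_at f x \<Longrightarrow> complex_diff_at (\<lambda>u. f u / k) x"
  using complex_diff_at_mult[OF _ complex_diff_at_const[of "inverse k"]] by (simp add: field_simps)

lemmas complex_diff_at_intros =
  complex_diff_at_const complex_diff_at_nth complex_diff_at_add complex_diff_at_mult
  complex_diff_at_minus complex_diff_at_diff complex_diff_at_power complex_diff_at_divide_const

lemma holomorphic_germI: "(\<And>x. complex_diff_at g x) \<Longrightarrow> holomorphic_germ g"
  by (simp add: holomorphic_germ_def)

lemma holomorphic_germ_at_0: "holomorphic_germ g \<Longrightarrow> complex_diff_at g 0"
  unfolding holomorphic_germ_def by (rule eventually_nhds_x_imp_x)

lemma biholomorphic_pairs_sym: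
  assumes "biholomorphic_pairs S T"
  shows "biholomorphic_pairs T S"
proof -
  obtain f where f: "biholomorphism f" "f ` S = T"
    using assms by (auto simp: biholomorphic_pairs_def)
  then have b: "bij f" by (simp add: biholomorphism_def)
  have "biholomorphism (inv f)"
    using f b by (simp add: biholomorphism_def bij_imp_bij_inv inv_inv_eq)
  moreover have "inv f ` T = S"
    using f(2) b by (metis bij_betw_imp_inj_on image_inv_f_f)
  ultimately show ?thesis
    by (auto simp: biholomorphic_pairs_def)
qed

section \<open>Monomial bases of the local algebras\<close>

text \<open>Dividing out the powers of the variable one at a time: the first nonzero coefficient of index at
most $N$ would be the limit of the quotient after cancelling.\<close>

lemma poly_vanishing_order:
  fixes p :: "complex poly"
  assumes lim: "((\<lambda>t. poly p t / t ^ N) \<longlongrightarrow> 0) (at 0)" and "n \<le> N"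
  shows "coeff p n = 0"
  using \<open>n \<le> N\<close>
proof (induction n rule: less_induct)
  case (less n)
  then have "monom 1 n dvd p"
    by (subst monom_1_dvd_iff') auto
  then obtain q where q: "p = monom 1 n * q" by (rule dvdE)
  have "((\<lambda>t. poly p t / t ^ N * t ^ (N - n)) \<longlongrightarrow> 0 * 0 ^ (N - n)) (at 0)"
    by (intro tendsto_intros lim)
  moreover have "\<forall>\<^sub>F t in at 0. poly p t / t ^ N * t ^ (N - n) = poly q t"
    using eventually_neq_at_within[of 0 0 UNIV]
  proof eventually_elim
    case (elim t)
    have "t ^ N = t ^ n * t ^ (N - n)" using less.prems by (simp flip: power_add)
    then show ?case using elim by (simp add: q poly_monom)
  qed
  ultimately have "(poly q \<longlongrightarrow> 0) (at 0)"
    by (simp add: tendsto_cong)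
  moreover have "(poly q \<longlongrightarrow> poly q 0) (at 0)"
    by (intro tendsto_intros)
  ultimately have "poly q 0 = 0"
    by (metis LIM_unique)
  then show ?case
    by (simp add: q coeff_monom_mult poly_0_coeff_0)
qed

lemma monom2_curve:
  "monom2 m (vector [\<alpha> * t ^ p, \<beta> * t ^ q]) =
     \<alpha> ^ fst m * \<beta> ^ snd m * t ^ (p * fst m + q * snd m)"
  by (simp add: monom2_def power_mult_distrib power_add mult_ac flip: power_mult)

lemma complex_diff_at_monom2: "complex_diff_at (monom2 m) x"
  unfolding monom2_def by (intro complex_diff_at_intros)

lemma tendsto_curve_0:
  fixes \<alpha> \<beta> :: complex
  assumes "0 < p" "0 < q"
  shows "((\<lambda>t. vector [\<alpha> * t ^ p, \<beta> * t ^ q] :: complex^2) \<longlongrightarrow> 0) (at 0)"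
proof (rule vec_tendstoI)
  fix i :: 2
  have "((\<lambda>t. \<alpha> * t ^ p) \<longlongrightarrow> \<alpha> * 0 ^ p) (at 0)" "((\<lambda>t. \<beta> * t ^ q) \<longlongrightarrow> \<beta> * 0 ^ q) (at 0)"
    by (intro tendsto_intros)+
  then show "((\<lambda>t. (vector [\<alpha> * t ^ p, \<beta> * t ^ q] :: complex^2) $ i) \<longlongrightarrow> 0 $ i) (at 0)"
    using assms exhaust_2[of i] by (auto simp: zero_power)
qed

definition jacobian_combination ::
    "(complex^2 \<Rightarrow> complex) \<Rightarrow> (complex^2 \<Rightarrow> complex) \<Rightarrow> (complex^2 \<Rightarrow> complex) \<Rightarrow> complex^2 \<Rightarrow> complex" where
  "jacobian_combination f \<xi> \<eta> u = \<xi> u * partial_deriv 1 f u + \<eta> u * partial_deriv 2 f u"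

text \<open>A linear functional on germs that annihilates the Jacobian ideal must be nonzero on some basis
monomial as soon as it is nonzero on one monomial. The functionals here are coefficients of $t^N$ of
$g(\alpha t^p, \beta t^q) + \varepsilon g(-\alpha t^p, \beta t^q)$. Taking $\varepsilon = \pm 1$ selects the
monomials whose first exponent has a given parity, and separates monomials of equal weight. The
hypothesis \<open>test\<close> says that the Jacobian ideal contributes nothing up to order $N$; it will
follow from the continuity or the differentiability of the germs at the origin.\<close>

lemma basis_monomial_detected:
  fixes \<alpha> \<beta> \<epsilon> :: complex
  assumes mini: "monomial_R_miniversal f B"
    and pq: "0 < p" "0 < q"
    and test: "\<And>\<xi> \<eta>. holomorphic_germ \<xi> \<Longrightarrow> holomorphic_germ \<eta> \<Longrightarrow>
       ((\<lambda>t. (jacobian_combination f \<xi> \<eta> (vector [\<alpha> * t ^ p, \<beta> * t ^ q])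
              + \<epsilon> * jacobian_combination f \<xi> \<eta> (vector [- \<alpha> * t ^ p, \<beta> * t ^ q])) / t ^ N) \<longlongrightarrow> 0) (at 0)"
    and nz: "(1 + \<epsilon> * (-1) ^ i') * \<alpha> ^ i' * \<beta> ^ j' \<noteq> 0"
    and N: "p * i' + q * j' = N"
  shows "\<exists>(i, j)\<in>B. p * i + q * j = N \<and> (1 + \<epsilon> * (-1) ^ i) * \<alpha> ^ i * \<beta> ^ j \<noteq> 0"
proof (rule ccontr)
  assume none: "\<not> ?thesis"
  \<comment> \<open>The value of the functional on a monomial, and the order at which it appears.\<close>
  define w where "w m = (1 + \<epsilon> * (-1) ^ fst m) * \<alpha> ^ fst m * \<beta> ^ snd m" for m :: "nat \<times> nat"
  define d where "d m = p * fst m + q * snd m" for m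
  have "holomorphic_germ (monom2 (i', j'))"
    by (intro holomorphic_germI complex_diff_at_monom2)
  then obtain \<mu> where "in_jacobian_ideal f (\<lambda>u. monom2 (i', j') u - (\<Sum>m\<in>B. \<mu> m * monom2 m u))"
    using mini unfolding monomial_R_miniversal_def by blast
  then obtain \<xi> \<eta> where hol: "holomorphic_germ \<xi>" "holomorphic_germ \<eta>" and
    ev: "\<forall>\<^sub>F u in nhds 0. monom2 (i', j') u - (\<Sum>m\<in>B. \<mu> m * monom2 m u) = jacobian_combination f \<xi> \<eta> u"
    unfolding in_jacobian_ideal_def jacobian_combination_def by blast
  define P where "P = monom (w (i', j')) N - (\<Sum>m\<in>B. monom (\<mu> m * w m) (d m))"
  let ?h = "\<lambda>u. monom2 (i', j') u - (\<Sum>m\<in>B. \<mu> m * monom2 m u)"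
  have P: "poly P t = ?h (vector [\<alpha> * t ^ p, \<beta> * t ^ q]) + \<epsilon> * ?h (vector [- \<alpha> * t ^ p, \<beta> * t ^ q])" for t
    using N unfolding P_def monom2_curve w_def d_def
    by (simp add: poly_monom poly_sum power_minus[of \<alpha>] algebra_simps sum.distrib sum_distrib_left)
  have "\<forall>\<^sub>F t in at 0. ?h (vector [\<gamma> * t ^ p, \<beta> * t ^ q]) =
          jacobian_combination f \<xi> \<eta> (vector [\<gamma> * t ^ p, \<beta> * t ^ q])" for \<gamma>
    using eventually_compose_filterlim[OF ev tendsto_curve_0[OF pq]] by simp
  from this[of \<alpha>] this[of "- \<alpha>"]
  have "\<forall>\<^sub>F t in at 0. (jacobian_combination f \<xi> \<eta> (vector [\<alpha> * t ^ p, \<beta> * t ^ q])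
              + \<epsilon> * jacobian_combination f \<xi> \<eta> (vector [- \<alpha> * t ^ p, \<beta> * t ^ q])) / t ^ N = poly P t / t ^ N"
    by eventually_elim (simp add: P)
  then have "((\<lambda>t. poly P t / t ^ N) \<longlongrightarrow> 0) (at 0)"
    by (rule Lim_transform_eventually[OF test[OF hol]])
  then have "coeff P N = 0" by (rule poly_vanishing_order) simp
  moreover have "coeff P N = w (i', j')"
  proof -
    have "coeff (monom (\<mu> m * w m) (d m)) N = 0" if "m \<in> B" for m
      using none that by (cases m) (auto simp: w_def d_def)
    then show ?thesis by (simp add: P_def coeff_sum)
  qed
  ultimately show False using nz by (simp add: w_def)
qed

text \<open>The coefficients of a combination of basis monomials are unique, so two of them cannot be
proportional in the local algebra.\<close>

lemma basis_independent_pair: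
  assumes mini: "monomial_R_miniversal f B" and "m \<in> B" "m' \<in> B" "m \<noteq> m'" "k \<noteq> 0"
  shows "\<not> in_jacobian_ideal f (\<lambda>u. k * monom2 m u + k' * monom2 m' u)"
proof
  assume *: "in_jacobian_ideal f (\<lambda>u. k * monom2 m u + k' * monom2 m' u)"
  have fin: "finite B" using mini by (simp add: monomial_R_miniversal_def)
  let ?\<mu> = "\<lambda>n. if n = m then k else if n = m' then k' else 0"
  have "(\<Sum>n\<in>B. ?\<mu> n * monom2 n u) = (\<Sum>n\<in>{m, m'}. ?\<mu> n * monom2 n u)" for u
    using assms(2,3) fin by (intro sum.mono_neutral_right) auto
  also have "\<dots> u = k * monom2 m u + k' * monom2 m' u" for u
    using assms(4) by simp
  finally have "in_jacobian_ideal f (\<lambda>u. \<Sum>n\<in>B. ?\<mu> n * monom2 n u)"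
    using * by simp
  moreover have "in_jacobian_ideal f (\<lambda>u. \<Sum>n\<in>B. ?\<mu> n * monom2 n u) \<longrightarrow> (\<forall>n\<in>B. ?\<mu> n = 0)"
    using mini unfolding monomial_R_miniversal_def by (elim conjE allE)
  ultimately have "\<forall>n\<in>B. ?\<mu> n = 0" by blast
  then show False using assms by auto
qed

lemma basis_monomial_notin_ideal:
  assumes mini: "monomial_R_miniversal f B" and "in_jacobian_ideal f (monom2 m)"
  shows "m \<notin> B"
proof
  assume "m \<in> B"
  have fin: "finite B" using mini by (simp add: monomial_R_miniversal_def)
  let ?\<mu> = "\<lambda>n. if n = m then 1 else 0 :: complex"
  have "(\<Sum>n\<in>B. ?\<mu> n * monom2 n u) = (\<Sum>n\<in>{m}. ?\<mu> n * monom2 n u)" for u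
    using \<open>m \<in> B\<close> fin by (intro sum.mono_neutral_right) auto
  then have "in_jacobian_ideal f (\<lambda>u. \<Sum>n\<in>B. ?\<mu> n * monom2 n u)"
    using assms(2) by simp
  moreover have "in_jacobian_ideal f (\<lambda>u. \<Sum>n\<in>B. ?\<mu> n * monom2 n u) \<longrightarrow> (\<forall>n\<in>B. ?\<mu> n = 0)"
    using mini unfolding monomial_R_miniversal_def by (elim conjE allE)
  ultimately have "\<forall>n\<in>B. ?\<mu> n = 0" by blast
  then show False using \<open>m \<in> B\<close> by auto
qed

lemma germ_tendsto_curve:
  fixes g :: "complex^2 \<Rightarrow> complex"
  assumes "holomorphic_germ g" "0 < p" "0 < q"
  shows "((\<lambda>t. g (vector [\<alpha> * t ^ p, \<beta> * t ^ q])) \<longlongrightarrow> g 0) (at 0)"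
proof -
  obtain D where "(g has_derivative D) (at 0)"
    using holomorphic_germ_at_0[OF assms(1)] by (auto simp: complex_diff_at_def)
  then have "isCont g 0" by (rule has_derivative_continuous)
  then show ?thesis
    using tendsto_curve_0[OF assms(2,3)] by (rule isCont_tendsto_compose[where g = g])
qed

text \<open>For $p \ge 2$ the two curves have the same velocity at the origin, so by the chain rule the
difference of the values has derivative zero there.\<close>

lemma germ_difference_tendsto:
  fixes g :: "complex^2 \<Rightarrow> complex"
  assumes "holomorphic_germ g" "2 \<le> p"
  shows "((\<lambda>t. (g (vector [\<alpha> * t ^ p, t]) - g (vector [\<alpha>' * t ^ p, t])) / t) \<longlongrightarrow> 0) (at 0)"
proof -
  obtain D where D: "(g has_derivative D) (at 0)" "\<And>c v. D (c *s v) = c * D v"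
    using holomorphic_germ_at_0[OF assms(1)] by (auto simp: complex_diff_at_def)
  have z: "(vector [\<gamma> * 0 ^ p, 0] :: complex^2) = 0" for \<gamma>
    using assms(2) by (simp add: vec_eq_iff forall_2)
  have der: "((\<lambda>t. g (vector [\<gamma> * t ^ p, t])) has_field_derivative D (vector [0, 1])) (at 0)" for \<gamma>
  proof -
    have "((\<lambda>t. vector [\<gamma> * t ^ p, t] :: complex^2) has_derivative (\<lambda>h. vector [0, h])) (at 0)"
    proof (rule has_derivative_vec_componentwise)
      fix i :: 2
      have "((\<lambda>t. \<gamma> * t ^ p) has_derivative (\<lambda>h. 0)) (at 0)"
        using assms(2) by (auto intro!: derivative_eq_intros simp: fun_eq_iff zero_power)
      then show "((\<lambda>t. (vector [\<gamma> * t ^ p, t] :: complex^2) $ i) has_derivative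
                   (\<lambda>h. (vector [0, h] :: complex^2) $ i)) (at 0)"
        using exhaust_2[of i] by auto
    qed
    then have "((\<lambda>t. g (vector [\<gamma> * t ^ p, t])) has_derivative (\<lambda>h. D (vector [0, h]))) (at 0)"
      by (rule has_derivative_compose[where g = g and g' = D]) (simp only: z D(1))
    moreover have "D (vector [0, h]) = D (vector [0, 1]) * h" for h :: complex
    proof -
      have "vector [0, h] = h *s (vector [0, 1] :: complex^2)"
        by (simp add: vec_eq_iff forall_2)
      then have "D (vector [0, h]) = D (h *s vector [0, 1])" by (rule arg_cong)
      also have "\<dots> = D (vector [0, 1]) * h" unfolding D(2) by (rule mult.commute)
      finally show ?thesis .
    qed
    then have "(\<lambda>h. D (vector [0, h])) = (*) (D (vector [0, 1]))"
      by (rule ext)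
    ultimately show ?thesis
      unfolding has_field_derivative_def by metis
  qed
  have "((\<lambda>t. g (vector [\<alpha> * t ^ p, t]) - g (vector [\<alpha>' * t ^ p, t])) has_field_derivative
           D (vector [0, 1]) - D (vector [0, 1])) (at 0)"
    by (intro DERIV_diff der)
  then have "((\<lambda>t. ((g (vector [\<alpha> * t ^ p, t]) - g (vector [\<alpha>' * t ^ p, t])) - (g (vector [\<alpha> * 0 ^ p, 0]) - g (vector [\<alpha>' * 0 ^ p, 0]))) / (t - 0)) \<longlongrightarrow> D (vector [0, 1]) - D (vector [0, 1])) (at 0)"
    unfolding has_field_derivative_iff .
  then show ?thesis
    unfolding z by simp
qed

lemma tendsto_power_quotient:
  fixes \<phi> :: "complex \<Rightarrow> complex"
  assumes "(\<phi> \<longlongrightarrow> L) (at 0)" "N < M \<or> L = 0 \<and> N \<le> M"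
  shows "((\<lambda>t. \<phi> t * t ^ M / t ^ N) \<longlongrightarrow> 0) (at 0)"
proof -
  have "((\<lambda>t. \<phi> t * t ^ (M - N)) \<longlongrightarrow> L * 0 ^ (M - N)) (at 0)"
    by (intro tendsto_intros assms(1))
  also have "L * 0 ^ (M - N) = 0" using assms(2) by auto
  finally have "((\<lambda>t. \<phi> t * t ^ (M - N)) \<longlongrightarrow> 0) (at 0)" .
  moreover have "\<forall>\<^sub>F t in at 0. \<phi> t * t ^ (M - N) = \<phi> t * t ^ M / t ^ N"
    using eventually_neq_at_within[of 0 0 UNIV]
  proof eventually_elim
    case (elim t)
    have "t ^ M = t ^ N * t ^ (M - N)" using assms(2) by (auto simp flip: power_add)
    then show ?case using elim by simp
  qed
  ultimately show ?thesis by (simp add: tendsto_cong)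
qed

lemma partial_deriv_eq: "(f has_derivative D) (at u) \<Longrightarrow> partial_deriv i f u = D (axis i 1)"
  unfolding partial_deriv_def by (metis frechet_derivative_at)

lemma in_jacobian_idealI:
  assumes "\<And>x. complex_diff_at \<xi> x" "\<And>x. complex_diff_at \<eta> x"
    "\<And>u. g u = \<xi> u * partial_deriv 1 f u + \<eta> u * partial_deriv 2 f u"
  shows "in_jacobian_ideal f g"
  unfolding in_jacobian_ideal_def
  by (intro exI[of _ \<xi>] exI[of _ \<eta>] conjI holomorphic_germI always_eventually allI assms)

lemma partial_deriv_odd_function_I:
  "partial_deriv 1 (odd_function (Type_I k)) u = (u $ 2)\<^sup>2 + of_nat (2 * k + 1) * (u $ 1) ^ (2 * k)"
  "partial_deriv 2 (odd_function (Type_I k)) u = 2 * u $ 1 * u $ 2"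
proof -
  have eq: "odd_function (Type_I k) = (\<lambda>u. u $ 1 * (u $ 2)\<^sup>2 + (u $ 1) ^ (2 * k + 1))"
    by (simp add: fun_eq_iff Let_def)
  have pow: "u $ 1 * u $ 1 ^ (k * 2 - Suc 0) = u $ 1 ^ (k * 2)" if "0 < k"
    using that by (simp flip: power_Suc)
  have "(odd_function (Type_I k) has_derivative
     (\<lambda>h. h $ 1 * (u $ 2)\<^sup>2 + u $ 1 * (2 * u $ 2 * h $ 2) + of_nat (2 * k + 1) * (u $ 1) ^ (2 * k) * h $ 1)) (at u)"
    unfolding eq by (auto intro!: derivative_eq_intros simp: fun_eq_iff algebra_simps dest: pow)
  from partial_deriv_eq[OF this]
  show "partial_deriv 1 (odd_function (Type_I k)) u = (u $ 2)\<^sup>2 + of_nat (2 * k + 1) * (u $ 1) ^ (2 * k)"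
  "partial_deriv 2 (odd_function (Type_I k)) u = 2 * u $ 1 * u $ 2"
    by (simp_all add: axis_def)
qed

text \<open>The Jacobian ideal is generated by $c^2 + (2k+1) a^{2k}$ and $a c$. Along the axis $c = 0$ its members
vanish to order $2k$, which forces the odd powers of $a$ below $2k$ into the basis; along $a = 0$ they
vanish to order $2$, which forces $c$. Every other odd monomial lies in the ideal, because
$a^{2k+1}$ and $c^3$ do.\<close>

lemma odd_monomials_I:
  assumes mini: "monomial_R_miniversal (odd_function (Type_I k)) B" and "1 \<le> k"
  shows "odd_monomials B = insert (0, 1) ((\<lambda>i. (2 * i + 1, 0)) ` {..<k})"
proof
  let ?f = "odd_function (Type_I k)"
  note pd = partial_deriv_odd_function_I
  show "odd_monomials B \<subseteq> insert (0, 1) ((\<lambda>i. (2 * i + 1, 0)) ` {..<k})"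
  proof
    fix m assume m: "m \<in> odd_monomials B"
    obtain i j where ij: "m = (i, j)" by (cases m)
    have B: "(i, j) \<in> B" and odd: "odd (i + j)" using m ij by (auto simp: odd_monomials_def)
    have notin: "\<not> in_jacobian_ideal ?f (monom2 (i, j))"
      using basis_monomial_notin_ideal[OF mini] B by blast
    have "j = 0 \<and> i < 2 * k \<or> j = 0 \<and> 2 * k + 1 \<le> i \<or> 1 \<le> i \<and> 1 \<le> j \<or> i = 0 \<and> j = 1 \<or> i = 0 \<and> 3 \<le> j"
      using odd by presburger
    then consider (a) "j = 0" "i < 2 * k" | (b) "j = 0" "2 * k + 1 \<le> i" | (c) "1 \<le> i" "1 \<le> j"
      | (d) "i = 0" "j = 1" | (e) "i = 0" "3 \<le> j"
      by blast
    then show "m \<in> insert (0, 1) ((\<lambda>i. (2 * i + 1, 0)) ` {..<k})"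
    proof cases
      case a
      then obtain l where "i = 2 * l + 1" using odd by (auto elim: oddE)
      then show ?thesis using a by (auto simp: ij)
    next
      case b
      then obtain r where r: "i = 2 * k + 1 + r" using le_Suc_ex by blast
      let ?n = "of_nat (2 * k + 1) :: complex"
      have n0: "?n \<noteq> 0" by (simp only: of_nat_eq_0_iff)
      have "in_jacobian_ideal ?f (monom2 (i, j))"
      proof (rule in_jacobian_idealI[where \<xi> = "\<lambda>u. (u $ 1) ^ (r + 1) / ?n"
              and \<eta> = "\<lambda>u. - ((u $ 1) ^ r * u $ 2 / (2 * ?n))"])
        show "monom2 (i, j) u = (u $ 1) ^ (r + 1) / ?n * partial_deriv 1 ?f u +
                - ((u $ 1) ^ r * u $ 2 / (2 * ?n)) * partial_deriv 2 ?f u" for u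
          unfolding pd monom2_def using n0 b(1)
          by (simp add: r field_simps power_add power2_eq_square del: of_nat_Suc of_nat_add)
      qed (intro complex_diff_at_intros)+
      then show ?thesis using notin by blast
    next
      case c
      then obtain i' j' where "i = Suc i'" "j = Suc j'" by (metis Suc_le_D One_nat_def)
      have "in_jacobian_ideal ?f (monom2 (i, j))"
        by (rule in_jacobian_idealI[where \<xi> = "\<lambda>u. 0" and \<eta> = "\<lambda>u. (u $ 1) ^ i' * (u $ 2) ^ j' / 2"])
           (intro complex_diff_at_intros | simp add: pd monom2_def \<open>i = _\<close> \<open>j = _\<close>)+
      then show ?thesis using notin by blast
    next
      case d
      then show ?thesis by (simp add: ij)
    next
      case e
      then obtain r where r: "j = 3 + r" using le_Suc_ex by blast
      obtain k' where k': "k = Suc k'" using \<open>1 \<le> k\<close> by (cases k) auto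
      have "in_jacobian_ideal ?f (monom2 (i, j))"
      proof (rule in_jacobian_idealI[where \<xi> = "\<lambda>u. (u $ 2) ^ (r + 1)"
              and \<eta> = "\<lambda>u. - (of_nat (2 * k + 1) / 2 * (u $ 1) ^ (2 * k' + 1) * (u $ 2) ^ r)"])
        show "monom2 (i, j) u = (u $ 2) ^ (r + 1) * partial_deriv 1 ?f u +
                - (of_nat (2 * k + 1) / 2 * (u $ 1) ^ (2 * k' + 1) * (u $ 2) ^ r) * partial_deriv 2 ?f u" for u
          unfolding pd monom2_def using e(1)
          by (simp add: r k' field_simps power_add power2_eq_square eval_nat_numeral)
      qed (intro complex_diff_at_intros)+
      then show ?thesis using notin by blast
    qed
  qed
  have "(0, 1) \<in> B"
  proof -
    have "\<exists>(i, j)\<in>B. 1 * i + 1 * j = 1 \<and> (1 + 0 * (-1) ^ i) * (0 :: complex) ^ i * 1 ^ j \<noteq> 0"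
    proof (rule basis_monomial_detected[OF mini, where i' = 0 and j' = 1])
      fix \<xi> \<eta> :: "complex^2 \<Rightarrow> complex" assume "holomorphic_germ \<xi>" "holomorphic_germ \<eta>"
      have "((\<lambda>t. \<xi> (vector [0 * t ^ 1, 1 * t ^ 1]) * t ^ 2 / t ^ 1) \<longlongrightarrow> 0) (at 0)"
        by (rule tendsto_power_quotient[OF germ_tendsto_curve[OF \<open>holomorphic_germ \<xi>\<close>]]) auto
      then show "((\<lambda>t. (jacobian_combination ?f \<xi> \<eta> (vector [0 * t ^ 1, 1 * t ^ 1]) +
            0 * jacobian_combination ?f \<xi> \<eta> (vector [- 0 * t ^ 1, 1 * t ^ 1])) / t ^ 1) \<longlongrightarrow> 0) (at 0)"
        using \<open>1 \<le> k\<close> by (simp add: jacobian_combination_def pd zero_power)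
    qed auto
    then show ?thesis by (auto simp: power_0_left split: if_splits)
  qed
  moreover have "(2 * l + 1, 0) \<in> B" if "l < k" for l
  proof -
    have "\<exists>(i, j)\<in>B. 1 * i + 1 * j = 2 * l + 1 \<and> (1 + 0 * (-1) ^ i) * (1 :: complex) ^ i * 0 ^ j \<noteq> 0"
    proof (rule basis_monomial_detected[OF mini, where i' = "2 * l + 1" and j' = 0])
      fix \<xi> \<eta> :: "complex^2 \<Rightarrow> complex" assume "holomorphic_germ \<xi>" "holomorphic_germ \<eta>"
      have "((\<lambda>t. of_nat (2 * k + 1) * \<xi> (vector [1 * t ^ 1, 0 * t ^ 1]) * t ^ (2 * k) / t ^ (2 * l + 1)) \<longlongrightarrow> 0) (at 0)"
        by (rule tendsto_power_quotient[OF tendsto_mult_left[OF germ_tendsto_curve[OF \<open>holomorphic_germ \<xi>\<close>]]])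
           (use that in auto)
      then show "((\<lambda>t. (jacobian_combination ?f \<xi> \<eta> (vector [1 * t ^ 1, 0 * t ^ 1]) +
            0 * jacobian_combination ?f \<xi> \<eta> (vector [- 1 * t ^ 1, 0 * t ^ 1])) / t ^ (2 * l + 1)) \<longlongrightarrow> 0) (at 0)"
        by (simp add: jacobian_combination_def pd mult_ac)
    qed auto
    then show ?thesis by (auto simp: power_0_left split: if_splits)
  qed
  ultimately show "insert (0, 1) ((\<lambda>i. (2 * i + 1, 0)) ` {..<k}) \<subseteq> odd_monomials B"
    by (auto simp: odd_monomials_def)
qed

lemma partial_deriv_cubic_plus_power:
  fixes f :: "complex^2 \<Rightarrow> complex"
  assumes "f = (\<lambda>u. (u $ 1) ^ 3 + (u $ 2) ^ n)"
  shows "partial_deriv 1 f u = 3 * (u $ 1)\<^sup>2"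
    and "partial_deriv 2 f u = of_nat n * (u $ 2) ^ (n - 1)"
proof -
  have "(f has_derivative (\<lambda>h. 3 * (u $ 1)\<^sup>2 * h $ 1 + of_nat n * (u $ 2) ^ (n - 1) * h $ 2)) (at u)"
    unfolding assms by (auto intro!: derivative_eq_intros simp: fun_eq_iff algebra_simps)
  from partial_deriv_eq[OF this]
  show "partial_deriv 1 f u = 3 * (u $ 1)\<^sup>2" "partial_deriv 2 f u = of_nat n * (u $ 2) ^ (n - 1)"
    by (simp_all add: axis_def)
qed

text \<open>The ideal is $(b^2, c^{n-1})$. On the curves $(\pm t^3, t)$ its members have order at least
$\min(6, n-1)$, which detects the powers of $c$. For the monomials $b c^j$ the difference of both
curves gains one more order, because germs differ only by $o(t)$ between the two curves. With the
curve exponent $3$ this suffices for $n = 5$ and $n = 7$.\<close>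

lemma odd_monomials_cubic_plus_power:
  fixes f :: "complex^2 \<Rightarrow> complex"
  assumes f: "f = (\<lambda>u. (u $ 1) ^ 3 + (u $ 2) ^ n)" and n: "n = 5 \<or> n = 7"
    and mini: "monomial_R_miniversal f B"
  shows "odd_monomials B = {(i, j). i \<le> 1 \<and> j < n - 1 \<and> odd (i + j)}"
proof
  note pd = partial_deriv_cubic_plus_power[OF f]
  have n0: "n \<noteq> 0" using n by auto
  show "odd_monomials B \<subseteq> {(i, j). i \<le> 1 \<and> j < n - 1 \<and> odd (i + j)}"
  proof
    fix m assume m: "m \<in> odd_monomials B"
    obtain i j where ij: "m = (i, j)" by (cases m)
    have B: "(i, j) \<in> B" and odd: "odd (i + j)" using m ij by (auto simp: odd_monomials_def)
    have notin: "\<not> in_jacobian_ideal f (monom2 (i, j))"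
      using basis_monomial_notin_ideal[OF mini] B by blast
    have False if *: "2 \<le> i"
    proof -
      obtain r where r: "i = 2 + r" using le_Suc_ex[OF *] by blast
      have "in_jacobian_ideal f (monom2 (i, j))"
        by (rule in_jacobian_idealI[where \<xi> = "\<lambda>u. (u $ 1) ^ r * (u $ 2) ^ j / 3" and \<eta> = "\<lambda>u. 0"])
           (intro complex_diff_at_intros | simp add: pd monom2_def r power_add power2_eq_square)+
      then show ?thesis using notin by blast
    qed
    moreover have False if *: "n - 1 \<le> j"
    proof -
      obtain r where r: "j = n - 1 + r" using le_Suc_ex[OF *] by blast
      have "in_jacobian_ideal f (monom2 (i, j))"
        by (rule in_jacobian_idealI[where \<xi> = "\<lambda>u. 0" and \<eta> = "\<lambda>u. (u $ 1) ^ i * (u $ 2) ^ r / of_nat n"])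
           (intro complex_diff_at_intros | simp add: pd monom2_def r power_add n0)+
      then show ?thesis using notin by blast
    qed
    ultimately show "m \<in> {(i, j). i \<le> 1 \<and> j < n - 1 \<and> odd (i + j)}"
      using odd by (force simp: ij not_le)
  qed
  have mem: "(i0, j0) \<in> B" if ij: "i0 \<le> 1" "j0 < n - 1" "odd (i0 + j0)" for i0 j0
  proof -
    define \<epsilon> :: complex where "\<epsilon> = (if i0 = 0 then 1 else -1)"
    have nz: "(1 + \<epsilon> * (-1) ^ i) * 1 ^ i * (1 :: complex) ^ j \<noteq> 0 \<longleftrightarrow> even (i + i0)" for i j
      using ij by (cases "even i") (auto simp: \<epsilon>_def)
    have "\<exists>(i, j)\<in>B. 3 * i + 1 * j = 3 * i0 + 1 * j0 \<and> (1 + \<epsilon> * (-1) ^ i) * 1 ^ i * (1 :: complex) ^ j \<noteq> 0"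
    proof (rule basis_monomial_detected[OF mini, where i' = i0 and j' = j0])
      show "(1 + \<epsilon> * (-1) ^ i0) * 1 ^ i0 * (1 :: complex) ^ j0 \<noteq> 0" by (subst nz) simp
      fix \<xi> \<eta> :: "complex^2 \<Rightarrow> complex" assume h: "holomorphic_germ \<xi>" "holomorphic_germ \<eta>"
      let ?N = "3 * i0 + 1 * j0"
      let ?G = "\<lambda>g t. g (vector [1 * t ^ 3, 1 * t ^ 1]) + \<epsilon> * g (vector [- 1 * t ^ 3, 1 * t ^ 1])"
      have G: "((\<lambda>t. c * ?G g t * t ^ M / t ^ ?N) \<longlongrightarrow> 0) (at 0)"
        if g: "holomorphic_germ g" and M: "n - 1 \<le> M" for g :: "complex^2 \<Rightarrow> complex" and M c
      proof (cases "i0 = 0")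
        case True
        have "((\<lambda>t. c * ?G g t) \<longlongrightarrow> c * (g 0 + \<epsilon> * g 0)) (at 0)"
          by (intro tendsto_mult tendsto_add tendsto_const germ_tendsto_curve[OF g]) simp_all
        then show ?thesis
          by (rule tendsto_power_quotient) (use True ij M in auto)
      next
        case False
        then have "i0 = 1" using ij by simp
        then have "even j0" using ij by simp
        then obtain r where "j0 = 2 * r" by (rule evenE)
        then have "j0 + 3 \<le> n" using ij n by auto
        then have "?N \<le> M + 1" using \<open>i0 = 1\<close> M by simp
        have "((\<lambda>t. c * (?G g t / t)) \<longlongrightarrow> c * 0) (at 0)"
          using False germ_difference_tendsto[OF g, of 3 1 "-1"]
          by (intro tendsto_mult tendsto_const) (simp add: \<epsilon>_def)
        then have "((\<lambda>t. c * (?G g t / t) * t ^ (M + 1) / t ^ ?N) \<longlongrightarrow> 0) (at 0)"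
          by (rule tendsto_power_quotient) (use \<open>?N \<le> M + 1\<close> in simp)
        moreover have "\<forall>\<^sub>F t in at 0. c * (?G g t / t) * t ^ (M + 1) / t ^ ?N = c * ?G g t * t ^ M / t ^ ?N"
          using eventually_neq_at_within[of 0 0 UNIV] by eventually_elim simp
        ultimately show ?thesis by (rule Lim_transform_eventually)
      qed
      have "((\<lambda>t. 3 * ?G \<xi> t * t ^ 6 / t ^ ?N + of_nat n * ?G \<eta> t * t ^ (n - 1) / t ^ ?N) \<longlongrightarrow> 0 + 0) (at 0)"
        by (intro tendsto_add G h) (use n in auto)
      moreover have J: "jacobian_combination f \<xi> \<eta> (vector [\<alpha> * t ^ 3, 1 * t ^ 1]) =
          3 * \<xi> (vector [\<alpha> * t ^ 3, 1 * t ^ 1]) * t ^ 6 +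
          of_nat n * \<eta> (vector [\<alpha> * t ^ 3, 1 * t ^ 1]) * t ^ (n - 1)"
        if "\<alpha> = 1 \<or> \<alpha> = - 1" for \<alpha> t :: complex
        using that by (auto simp: jacobian_combination_def pd power_mult_distrib simp flip: power_mult)
      ultimately show "((\<lambda>t. (jacobian_combination f \<xi> \<eta> (vector [1 * t ^ 3, 1 * t ^ 1]) +
            \<epsilon> * jacobian_combination f \<xi> \<eta> (vector [- 1 * t ^ 3, 1 * t ^ 1])) / t ^ ?N) \<longlongrightarrow> 0) (at 0)"
        unfolding J[OF disjI1[OF refl]] J[OF disjI2[OF refl]]
        by (simp add: add_divide_distrib algebra_simps)
    qed auto
    then obtain i j where "(i, j) \<in> B" and e: "3 * i + j = 3 * i0 + j0" and "even (i + i0)"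
      unfolding nz by (auto simp del: even_add)
    moreover from e have "i = i0"
    proof -
      have "j0 \<le> 5" using ij n by auto
      then have "i \<le> 2" using ij(1) e by linarith
      then have "i = 0 \<or> i = 1 \<or> i = 2" "i0 = 0 \<or> i0 = 1" using ij(1) by auto
      then show ?thesis using e \<open>even (i + i0)\<close> \<open>j0 \<le> 5\<close> by auto
    qed
    ultimately show ?thesis by simp
  qed
  then show "{(i, j). i \<le> 1 \<and> j < n - 1 \<and> odd (i + j)} \<subseteq> odd_monomials B"
    by (auto simp: odd_monomials_def)
qed

lemma partial_deriv_odd_function_II5:
  "partial_deriv 1 (odd_function (Type_II II5)) u = 3 * (u $ 1)\<^sup>2 - (u $ 2) ^ 4"
  "partial_deriv 2 (odd_function (Type_II II5)) u = - 4 * u $ 1 * (u $ 2) ^ 3"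
proof -
  have eq: "odd_function (Type_II II5) = (\<lambda>u. (u $ 1) ^ 3 - u $ 1 * (u $ 2) ^ 4)"
    by (simp add: fun_eq_iff Let_def)
  have "(odd_function (Type_II II5) has_derivative
     (\<lambda>h. (3 * (u $ 1)\<^sup>2 - (u $ 2) ^ 4) * h $ 1 - 4 * u $ 1 * (u $ 2) ^ 3 * h $ 2)) (at u)"
    unfolding eq by (auto intro!: derivative_eq_intros simp: fun_eq_iff algebra_simps)
  from partial_deriv_eq[OF this]
  show "partial_deriv 1 (odd_function (Type_II II5)) u = 3 * (u $ 1)\<^sup>2 - (u $ 2) ^ 4"
    "partial_deriv 2 (odd_function (Type_II II5)) u = - 4 * u $ 1 * (u $ 2) ^ 3"
    by (simp_all add: axis_def)
qed

text \<open>The curves $(\pm s t^2, t)$ with $3 s^2 = 1$ annihilate the first generator $3 b^2 - c^4$, and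
$b c^3$ has order $5$ on them. Hence weights up to $4$ are detected, and in weight $5$ the sum of both
curves still is, because the leading terms of $\pm b c^3$ cancel. That weight contains $c^5$ and
$b^2 c$, of which at least one is in the basis; the relation $3 b^2 c = c^5$ modulo the ideal excludes
both.\<close>

lemma odd_monomials_II5:
  assumes mini: "monomial_R_miniversal (odd_function (Type_II II5)) B"
  obtains e where "e = (0, 5) \<or> e = (2, 1)" "odd_monomials B = {(0, 1), (0, 3), (1, 0), (1, 2), e}"
proof -
  let ?f = "odd_function (Type_II II5)"
  note pd = partial_deriv_odd_function_II5
  have sub: "odd_monomials B \<subseteq> {(0, 1), (0, 3), (1, 0), (1, 2), (0, 5), (2, 1)}"
  proof
    fix m assume m: "m \<in> odd_monomials B"
    obtain i j where ij: "m = (i, j)" by (cases m)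
    have B: "(i, j) \<in> B" and odd: "odd (i + j)" using m ij by (auto simp: odd_monomials_def)
    have notin: "\<not> in_jacobian_ideal ?f (monom2 (i, j))"
      using basis_monomial_notin_ideal[OF mini] B by blast
    have n1: False if *: "1 \<le> i" "3 \<le> j"
    proof -
      obtain r s where r: "i = 1 + r" "j = 3 + s"
        using le_Suc_ex[OF *(1)] le_Suc_ex[OF *(2)] by blast
      have "in_jacobian_ideal ?f (monom2 (i, j))"
        by (rule in_jacobian_idealI[where \<xi> = "\<lambda>u. 0" and \<eta> = "\<lambda>u. - ((u $ 1) ^ r * (u $ 2) ^ s / 4)"])
           (intro complex_diff_at_intros | simp add: pd monom2_def r power_add)+
      then show ?thesis using notin by blast
    qed
    have n2: False if *: "3 \<le> i"
    proof -
      obtain r where r: "i = 3 + r" using le_Suc_ex[OF *] by blast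
      have "in_jacobian_ideal ?f (monom2 (i, j))"
        by (rule in_jacobian_idealI[where \<xi> = "\<lambda>u. (u $ 1) ^ (r + 1) * (u $ 2) ^ j / 3"
              and \<eta> = "\<lambda>u. - ((u $ 1) ^ r * (u $ 2) ^ (j + 1) / 12)"])
           (intro complex_diff_at_intros
            | simp add: pd monom2_def r power_add field_simps power2_eq_square eval_nat_numeral)+
      then show ?thesis using notin by blast
    qed
    have n3: False if *: "i = 0" "7 \<le> j"
    proof -
      obtain r where r: "j = 7 + r" using le_Suc_ex[OF *(2)] by blast
      have "in_jacobian_ideal ?f (monom2 (i, j))"
        by (rule in_jacobian_idealI[where \<xi> = "\<lambda>u. - ((u $ 2) ^ (r + 3))"
              and \<eta> = "\<lambda>u. - (3 / 4 * u $ 1 * (u $ 2) ^ r)"])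
           (intro complex_diff_at_intros
            | simp add: pd monom2_def r * power_add field_simps power2_eq_square eval_nat_numeral)+
      then show ?thesis using notin by blast
    qed
    have "\<not> (1 \<le> i \<and> 3 \<le> j)" "\<not> 3 \<le> i" "\<not> (i = 0 \<and> 7 \<le> j)"
      using n1 n2 n3 by blast+
    then have "i \<le> 2" "i = 0 \<and> j \<le> 6 \<or> j \<le> 2"
      by linarith+
    then have "i \<in> {0, 1, 2}" "j \<in> {0, 1, 2, 3, 4, 5, 6}" "i = 0 \<or> j \<le> 2" by auto
    then show "m \<in> {(0, 1), (0, 3), (1, 0), (1, 2), (0, 5), (2, 1)}"
      using odd by (auto simp: ij)
  qed
  \<comment> \<open>Chosen such that $3 b^2 = c^4$ on the curves $(\pm s t^2, t)$.\<close>
  define s where "s = 1 / csqrt 3"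
  have s: "3 * s\<^sup>2 = 1" by (simp only: s_def power_divide power2_csqrt) simp
  then have "s \<noteq> 0" by auto
  have det: "\<exists>(i, j)\<in>B. 2 * i + j = 2 * i0 + j0 \<and> even (i + i0)"
    if ij: "2 * i0 + j0 \<le> 4 \<or> even i0 \<and> 2 * i0 + j0 = 5" for i0 j0
  proof -
    \<comment> \<open>The sign that keeps exactly the monomials whose first exponent has the parity of \<open>i0\<close>.\<close>
    define \<epsilon> :: complex where "\<epsilon> = (if even i0 then 1 else -1)"
    have nz: "(1 + \<epsilon> * (-1) ^ i) * s ^ i * (1 :: complex) ^ j \<noteq> 0 \<longleftrightarrow> even (i + i0)" for i j
      using \<open>s \<noteq> 0\<close> by (cases "even i") (auto simp: \<epsilon>_def)
    have "\<exists>(i, j)\<in>B. 2 * i + 1 * j = 2 * i0 + 1 * j0 \<and> (1 + \<epsilon> * (-1) ^ i) * s ^ i * (1 :: complex) ^ j \<noteq> 0"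
    proof (rule basis_monomial_detected[OF mini, where i' = i0 and j' = j0])
      show "(1 + \<epsilon> * (-1) ^ i0) * s ^ i0 * (1 :: complex) ^ j0 \<noteq> 0" by (subst nz) simp
      fix \<xi> \<eta> :: "complex^2 \<Rightarrow> complex" assume h: "holomorphic_germ \<xi>" "holomorphic_germ \<eta>"
      let ?N = "2 * i0 + 1 * j0"
      \<comment> \<open>The curve lies in the zero set of the first generator of the ideal.\<close>
      have cancel: "3 * (s * t ^ 2)\<^sup>2 - t ^ 4 = 0" for t
        using s by (simp add: power_mult_distrib flip: power_mult)
      have "((\<lambda>t. - 4 * s * (\<eta> (vector [s * t ^ 2, 1 * t ^ 1]) - \<epsilon> * \<eta> (vector [- s * t ^ 2, 1 * t ^ 1])))
               \<longlongrightarrow> - 4 * s * (\<eta> 0 - \<epsilon> * \<eta> 0)) (at 0)"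
        by (intro tendsto_mult tendsto_diff tendsto_const germ_tendsto_curve[OF h(2)]) simp_all
      then have "((\<lambda>t. - 4 * s * (\<eta> (vector [s * t ^ 2, 1 * t ^ 1]) - \<epsilon> * \<eta> (vector [- s * t ^ 2, 1 * t ^ 1])) * t ^ 5 / t ^ ?N) \<longlongrightarrow> 0) (at 0)"
        by (rule tendsto_power_quotient) (use ij in \<open>auto simp: \<epsilon>_def\<close>)
      moreover have J: "jacobian_combination ?f \<xi> \<eta> (vector [\<alpha> * t ^ 2, 1 * t ^ 1]) =
          - 4 * \<alpha> * \<eta> (vector [\<alpha> * t ^ 2, 1 * t ^ 1]) * t ^ 5" if "\<alpha> = s \<or> \<alpha> = - s" for \<alpha> t
        using that cancel[of t]
        by (auto simp: jacobian_combination_def pd power_mult_distrib eval_nat_numeral)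
      ultimately show "((\<lambda>t. (jacobian_combination ?f \<xi> \<eta> (vector [s * t ^ 2, 1 * t ^ 1]) +
            \<epsilon> * jacobian_combination ?f \<xi> \<eta> (vector [- s * t ^ 2, 1 * t ^ 1])) / t ^ ?N) \<longlongrightarrow> 0) (at 0)"
        unfolding J[OF disjI1[OF refl]] J[OF disjI2[OF refl]]
        by (simp add: algebra_simps)
    qed auto
    then show ?thesis unfolding nz by auto
  qed
  have one: "(i0, j0) \<in> B" if "(i0, j0) \<in> {(0, 1), (0, 3), (1, 0), (1, 2)}" for i0 j0
  proof -
    have small: "i0 = 0 \<and> j0 \<le> 3 \<or> i0 = 1 \<and> j0 \<le> 2"
      using that by auto
    then have "2 * i0 + j0 \<le> 4 \<or> even i0 \<and> 2 * i0 + j0 = 5" by auto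
    then obtain i j where "(i, j) \<in> B" "2 * i + j = 2 * i0 + j0" "even (i + i0)"
      using det by blast
    moreover from this have "i \<le> 2" using small by linarith
    then have "i = 0 \<or> i = 1 \<or> i = 2" by auto
    with calculation have "i = i0"
      using small by auto
    ultimately show ?thesis by simp
  qed
  have two: "(0, 5) \<in> B \<or> (2, 1) \<in> B"
  proof -
    obtain i j where ij: "(i, j) \<in> B" "2 * i + j = 5" "even i"
      using det[of 0 5] by auto
    then have "i \<le> 2" by linarith
    then have "i = 0 \<or> i = 1 \<or> i = 2" by auto
    then show ?thesis using ij by auto
  qed
  have "in_jacobian_ideal ?f (\<lambda>u. 3 * monom2 (2, 1) u + (-1) * monom2 (0, 5) u)"
    by (rule in_jacobian_idealI[where \<xi> = "\<lambda>u. u $ 2" and \<eta> = "\<lambda>u. 0"])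
       (intro complex_diff_at_intros | simp add: pd monom2_def algebra_simps eval_nat_numeral)+
  then have three: "\<not> ((0, 5) \<in> B \<and> (2, 1) \<in> B)"
    using basis_independent_pair[OF mini, of "(2, 1)" "(0, 5)" 3 "-1"] by auto
  show ?thesis
  proof (cases "(0, 5) \<in> B")
    case True
    have "odd_monomials B = {(0, 1), (0, 3), (1, 0), (1, 2), (0, 5)}"
      using sub one three True unfolding odd_monomials_def by auto
    then show ?thesis using that by blast
  next
    case False
    have "odd_monomials B = {(0, 1), (0, 3), (1, 0), (1, 2), (2, 1)}"
      using sub one two False unfolding odd_monomials_def by auto
    then show ?thesis using that by blast
  qed
qed

section \<open>Symmetric matrices of rank at most one\<close>

text \<open>The trace form on symmetric matrices. It is complex bilinear, so orthogonality with respect to it is a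
complex-linear condition, in contrast to orthogonality for the real inner product of the
underlying Euclidean space.\<close>

definition pairing :: "complex^3^3 \<Rightarrow> complex^3^3 \<Rightarrow> complex" where
  "pairing Q V = (\<Sum>i\<in>UNIV. \<Sum>j\<in>UNIV. Q $ i $ j * V $ i $ j)"

definition outer :: "complex^3 \<Rightarrow> complex^3^3" where
  "outer u = (\<chi> i j. u $ i * u $ j)"

text \<open>The $2 \times 2$ minors vanish: the rank is at most one. Unlike the rank itself, this condition can be
differentiated along a curve of matrices.\<close>

definition minors_vanish :: "complex^3^3 \<Rightarrow> bool" where
  "minors_vanish A \<longleftrightarrow> (\<forall>i j k l. A $ i $ j * A $ k $ l = A $ i $ l * A $ k $ j)"

lemma Sym3_iff: "A \<in> Sym3 \<longleftrightarrow> (\<forall>i j. A $ i $ j = A $ j $ i)"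
  by (auto simp: Sym3_def transpose_def vec_eq_iff)

text \<open>If some diagonal entry $A_{rr}$ is nonzero, dividing the $r$-th column by a square root of $A_{rr}$ gives
$u$. If the diagonal is zero, the minors give $A_{ij}^2 = A_{ii} A_{jj} = 0$.\<close>

lemma sym_minors_vanish_imp_outer:
  assumes "A \<in> Sym3" "minors_vanish A"
  shows "\<exists>u. A = outer u"
proof (cases "\<exists>r. A $ r $ r \<noteq> 0")
  case True
  then obtain r where r: "A $ r $ r \<noteq> 0" by blast
  let ?s = "csqrt (A $ r $ r)"
  have s: "?s * ?s = A $ r $ r"
    using power2_csqrt[of "A $ r $ r"] unfolding power2_eq_square .
  have "A $ i $ j = (A $ i $ r / ?s) * (A $ j $ r / ?s)" for i j
  proof -
    have "A $ i $ j * A $ r $ r = A $ i $ r * A $ r $ j"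
      using assms(2) unfolding minors_vanish_def by blast
    moreover have "A $ r $ j = A $ j $ r"
      using assms(1) unfolding Sym3_iff by blast
    ultimately have "A $ i $ j = A $ i $ r * A $ j $ r / (?s * ?s)"
      using r unfolding s by (simp add: eq_divide_eq)
    then show ?thesis by simp
  qed
  then have "A = outer (\<chi> i. A $ i $ r / ?s)"
    unfolding vec_eq_iff outer_def vec_lambda_beta by blast
  then show ?thesis ..
next
  case False
  have "A $ i $ j * A $ i $ j = 0" for i j
  proof -
    have "A $ i $ j * A $ j $ i = A $ i $ i * A $ j $ j"
      using assms(2) unfolding minors_vanish_def by blast
    moreover have "A $ j $ i = A $ i $ j"
      using assms(1) unfolding Sym3_iff by blast
    ultimately show ?thesis using False by simp
  qed
  then have "A = outer 0" by (simp add: outer_def vec_eq_iff)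
  then show ?thesis ..
qed

lemma outer_sym: "outer u \<in> Sym3"
  by (simp add: Sym3_iff outer_def mult.commute)

text \<open>The vectors $q$ and $r$ are independent, so $a$ and $b$ are both multiples of their cross product, whose
components are called $c_1, c_2, c_3$ in the proof.\<close>

lemma orthogonal_pair_collinear:
  fixes a b q r :: "complex^3"
  assumes "\<And>x. x = a \<or> x = b \<Longrightarrow> (\<Sum>i\<in>UNIV. x $ i * q $ i) = 0 \<and> (\<Sum>i\<in>UNIV. x $ i * r $ i) = 0"
    and ne: "q $ i * r $ j \<noteq> q $ j * r $ i"
  shows "a $ m * b $ n = a $ n * b $ m"
proof -
  define c1 where "c1 = q $ 2 * r $ 3 - q $ 3 * r $ 2"
  define c2 where "c2 = q $ 3 * r $ 1 - q $ 1 * r $ 3"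
  define c3 where "c3 = q $ 1 * r $ 2 - q $ 2 * r $ 1"
  have eqs: "x $ 1 * q $ 1 + x $ 2 * q $ 2 + x $ 3 * q $ 3 = 0"
    "x $ 1 * r $ 1 + x $ 2 * r $ 2 + x $ 3 * r $ 3 = 0" if "x = a \<or> x = b" for x
    using assms(1)[OF that] by (simp_all add: sum_3)
  have col: "x $ 1 * c2 = x $ 2 * c1" "x $ 1 * c3 = x $ 3 * c1" "x $ 2 * c3 = x $ 3 * c2"
    if "x = a \<or> x = b" for x
    using eqs[OF that] unfolding c1_def c2_def c3_def by algebra+
  have "c1 \<noteq> 0 \<or> c2 \<noteq> 0 \<or> c3 \<noteq> 0"
    using ne exhaust_3[of i] exhaust_3[of j] by (auto simp: c1_def c2_def c3_def)
  then have "\<exists>\<kappa>. x $ 1 = \<kappa> * c1 \<and> x $ 2 = \<kappa> * c2 \<and> x $ 3 = \<kappa> * c3" if "x = a \<or> x = b" for x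
  proof (elim disjE)
    assume "c1 \<noteq> 0" then show ?thesis
      using col[OF that] by (intro exI[of _ "x $ 1 / c1"]) (simp add: field_simps)
  next
    assume "c2 \<noteq> 0" then show ?thesis
      using col[OF that] by (intro exI[of _ "x $ 2 / c2"]) (simp add: field_simps)
  next
    assume "c3 \<noteq> 0" then show ?thesis
      using col[OF that] by (intro exI[of _ "x $ 3 / c3"]) (simp add: field_simps)
  qed
  then obtain \<kappa> \<kappa>' where
    "a $ 1 = \<kappa> * c1" "a $ 2 = \<kappa> * c2" "a $ 3 = \<kappa> * c3"
    "b $ 1 = \<kappa>' * c1" "b $ 2 = \<kappa>' * c2" "b $ 3 = \<kappa>' * c3" by blast
  then show ?thesis
    using exhaust_3[of m] exhaust_3[of n] by auto
qed

text \<open>If two columns of $Q$ are independent, every row of $A$ lies on the line orthogonal to both. So $A$ and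
$Q$ cannot both have rank two.\<close>

lemma complementary_minors_vanish:
  assumes "A ** Q = 0"
  shows "minors_vanish A \<or> minors_vanish Q"
proof (rule disjCI)
  assume "\<not> minors_vanish Q"
  then obtain i j k l where ne: "Q $ i $ j * Q $ k $ l \<noteq> Q $ i $ l * Q $ k $ j"
    unfolding minors_vanish_def by blast
  have AQ: "(\<Sum>m\<in>UNIV. A $ p $ m * Q $ m $ n) = 0" for p n
    using assms by (simp add: vec_eq_iff matrix_matrix_mult_def)
  have "A $ p $ m * A $ p' $ n = A $ p $ n * A $ p' $ m" for p p' m n
  proof (rule orthogonal_pair_collinear[where q = "column j Q" and r = "column l Q" and i = i and j = k])
    show "column j Q $ i * column l Q $ k \<noteq> column j Q $ k * column l Q $ i"
      using ne by (simp add: column_def mult.commute)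
  qed (auto simp: column_def AQ)
  then show "minors_vanish A" unfolding minors_vanish_def by metis
qed

lemma rank_le_1_minors_vanish:
  fixes A :: "complex^3^3"
  assumes "rank A \<le> 1"
  shows "minors_vanish A"
proof -
  obtain S where S: "S \<subseteq> rows A" "vec.independent S" "rows A \<subseteq> vec.span S" "card S = vec.dim (rows A)"
    using vec.basis_exists by blast
  have fin: "finite S" using S(2) by (rule vec.finiteI_independent)
  have "card S \<le> 1" using assms S(4) by (simp add: row_rank_def_gen)
  then obtain w where "S \<subseteq> {w}"
    using fin by (metis card_le_Suc0_iff_eq One_nat_def all_not_in_conv empty_subsetI insertCI subsetI)
  then have "rows A \<subseteq> vec.span {w}"
    using S(3) vec.span_mono by blast
  then have "\<exists>c. A $ i = c *s w" for i
    unfolding vec.span_singleton rows_def row_def by auto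
  then obtain c where "\<And>i. A $ i = c i *s w" by metis
  then show ?thesis by (simp add: minors_vanish_def)
qed

lemma outer_rank_le_1: "rank (outer u) \<le> 1"
proof -
  have "rows (outer u) \<subseteq> vec.span {u}"
  proof -
    have "row i (outer u) = u $ i *s u" for i
      by (simp add: row_def outer_def vec_eq_iff)
    then show ?thesis by (auto simp: rows_def vec.span_singleton)
  qed
  then have "vec.dim (rows (outer u)) \<le> card {u}"
    by (intro vec.dim_le_card) auto
  then show ?thesis by (simp add: row_rank_def_gen)
qed

lemma rank_0_iff: "rank (A :: complex^3^3) = 0 \<longleftrightarrow> A = 0"
proof -
  have "rows A \<subseteq> {0} \<longleftrightarrow> A = 0"
  proof
    assume "rows A \<subseteq> {0}"
    then have "row i A = 0" for i by (auto simp: rows_def)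
    then show "A = 0" by (simp add: vec_eq_iff row_def)
  qed (auto simp: rows_def row_def vec_eq_iff)
  then show ?thesis by (simp add: row_rank_def_gen)
qed

lemma rank_mult_left_le: "rank ((E :: complex^3^3) ** A) \<le> rank (A :: complex^3^3)"
proof -
  have "row i (E ** A) \<in> vec.span (rows A)" for i
  proof -
    have "row i (E ** A) = (\<Sum>k\<in>UNIV. E $ i $ k *s row k A)"
      by (simp add: vec_eq_iff row_def matrix_matrix_mult_def)
    also have "\<dots> \<in> vec.span (rows A)"
      by (intro vec.span_sum vec.span_scale vec.span_base) (auto simp: rows_def)
    finally show ?thesis .
  qed
  then show ?thesis
    unfolding row_rank_def_gen by (intro vec.dim_mono) (auto simp: rows_def)
qed

lemma rank_mult_right_le: "rank ((A :: complex^3^3) ** E) \<le> rank (A :: complex^3^3)"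
proof -
  have "rows (A ** E) = (*v) (transpose E) ` rows A"
    by (auto simp: rows_def row_def vec_eq_iff matrix_matrix_mult_def vector_matrix_mult_def mult.commute image_iff)
  then show ?thesis
    unfolding row_rank_def_gen using vec.dim_image_le[OF matrix_vector_mul_linear_gen, of "transpose E"] by simp
qed

text \<open>Congruence by invertible matrices acts on each corank stratum; its orbits supply the tangent
vectors below.\<close>

lemma rank_congruence:
  fixes A E :: "complex^3^3"
  assumes "invertible E"
  shows "rank (E ** A ** transpose E) = rank A"
proof (rule antisym)
  show "rank (E ** A ** transpose E) \<le> rank A"
    by (meson rank_mult_left_le rank_mult_right_le order_trans)
  obtain F where "F ** E = mat 1" using assms by (auto simp: invertible_def)
  then have "F ** (E ** A ** transpose E) ** transpose F = A"
    by (metis matrix_mul_assoc matrix_mul_lid matrix_mul_rid matrix_transpose_mul transpose_mat)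
  then show "rank A \<le> rank (E ** A ** transpose E)"
    by (metis rank_mult_left_le rank_mult_right_le order_trans)
qed

section \<open>Transversality to the corank strata\<close>

lemma tangent_space_subset_Sym3: "tangent_space (corank_stratum c) A \<subseteq> Sym3"
proof
  fix V assume "V \<in> tangent_space (corank_stratum c) A"
  then obtain \<gamma> :: "complex \<Rightarrow> complex^3^3" where
    ev: "\<forall>\<^sub>F t in nhds 0. \<gamma> t \<in> corank_stratum c" and
    V: "\<And>i j. deriv (\<lambda>t. \<gamma> t $ i $ j) 0 = V $ i $ j"
    by (auto simp: tangent_space_def)
  have "V $ i $ j = V $ j $ i" for i j
    unfolding V[symmetric]
    by (rule deriv_cong_ev[OF eventually_mono[OF ev]]) (auto simp: corank_stratum_def Sym3_iff)
  then show "V \<in> Sym3" by (simp add: Sym3_iff)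
qed

text \<open>The velocity of the curve $(1 + tX) A (1 + tX)^T$, which stays in the stratum as long as $1 + tX$ is
invertible.\<close>

lemma congruence_directions_tangent:
  assumes A: "A \<in> corank_stratum c"
  shows "X ** A + A ** transpose X \<in> tangent_space (corank_stratum c) A"
proof -
  define E where "E t = (\<chi> i j. (if i = j then 1 else 0) + t * X $ i $ j)" for t
  define \<gamma> where "\<gamma> t = E t ** A ** transpose (E t)" for t
  have \<gamma>: "\<gamma> t $ i $ j = A $ i $ j + t * ((X ** A + A ** transpose X) $ i $ j) + t\<^sup>2 * ((X ** A ** transpose X) $ i $ j)" for t i j
    using exhaust_3[of i] exhaust_3[of j]
    by (auto simp: \<gamma>_def E_def matrix_matrix_mult_def transpose_def sum_3 algebra_simps power2_eq_square)
  have "((\<lambda>t. det (E t)) \<longlongrightarrow> det (E 0)) (nhds 0)"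
    unfolding E_def det_3 tendsto_nhds_iff by (simp) (intro tendsto_eq_intros, auto)
  moreover have "det (E 0) = 1" by (simp add: E_def det_3)
  ultimately have "\<forall>\<^sub>F t in nhds 0. det (E t) \<noteq> 0"
    by (metis tendsto_imp_eventually_ne zero_neq_one)
  then have ev: "\<forall>\<^sub>F t in nhds 0. \<gamma> t \<in> corank_stratum c"
  proof eventually_elim
    case (elim t)
    then have "corank (\<gamma> t) = c"
      using A rank_congruence[of "E t" A] by (simp add: invertible_det_nz \<gamma>_def corank_stratum_def corank_def)
    moreover have "\<gamma> t \<in> Sym3"
      using A by (simp add: \<gamma>_def corank_stratum_def Sym3_def matrix_transpose_mul matrix_mul_assoc)
    ultimately show ?case by (simp add: corank_stratum_def)
  qed
  show ?thesis
    unfolding tangent_space_def mem_Collect_eq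
  proof (intro exI[of _ \<gamma>] conjI allI ev)
    show "\<gamma> 0 = A" by (simp add: vec_eq_iff \<gamma>)
    fix i j
    show "(\<lambda>t. \<gamma> t $ i $ j) analytic_on {0}"
      unfolding \<gamma> by (intro analytic_intros)
    show "deriv (\<lambda>t. \<gamma> t $ i $ j) 0 = (X ** A + A ** transpose X) $ i $ j"
      unfolding \<gamma> by (rule DERIV_imp_deriv) (auto intro!: derivative_eq_intros)
  qed
qed

text \<open>Differentiating the vanishing minors $\gamma_{ij} \gamma_{kl} = \gamma_{il} \gamma_{kj}$ at $t = 0$ and
contracting with $Q_{ij}$, every term but one contains $Q u = 0$. What remains is
$\langle Q, V \rangle u_k u_l = 0$. If $u = 0$ the stratum is the zero matrix alone and $V = 0$.\<close>

lemma pairing_tangent_rank_one: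
  assumes Q: "Q \<in> Sym3" "Q *v u = 0" and V: "V \<in> tangent_space (corank_stratum c) (outer u)"
    and mem: "outer u \<in> corank_stratum c"
  shows "pairing Q V = 0"
proof -
  obtain \<gamma> :: "complex \<Rightarrow> complex^3^3" where \<gamma>0: "\<gamma> 0 = outer u" and
    ev: "\<forall>\<^sub>F t in nhds 0. \<gamma> t \<in> corank_stratum c" and
    an: "\<And>i j. (\<lambda>t. \<gamma> t $ i $ j) analytic_on {0}" and
    dV: "\<And>i j. deriv (\<lambda>t. \<gamma> t $ i $ j) 0 = V $ i $ j"
    using V by (auto simp: tangent_space_def)
  have der: "((\<lambda>t. \<gamma> t $ i $ j) has_field_derivative V $ i $ j) (at 0)" for i j
    using an[of i j] dV[of i j] by (metis analytic_on_imp_differentiable_at DERIV_deriv_iff_field_differentiable singletonI)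
  have rank1: "c = 3 - rank (outer u)"
    using mem by (simp add: corank_stratum_def corank_def)
  show ?thesis
  proof (cases "outer u = 0")
    case True
    then have "rank (outer u) = 0" by (subst rank_0_iff)
    then have "c = 3" using rank1 by simp
    have "\<forall>\<^sub>F t in nhds 0. \<gamma> t $ i $ j = 0" for i j
      using ev
    proof eventually_elim
      case (elim t)
      then have "3 - rank (\<gamma> t) = 3" by (simp add: \<open>c = 3\<close> corank_stratum_def corank_def)
      then have "rank (\<gamma> t) = 0" by arith
      then show ?case by (simp add: rank_0_iff)
    qed
    then have "V $ i $ j = 0" for i j
      using deriv_cong_ev[of "\<lambda>t. \<gamma> t $ i $ j" "\<lambda>_. 0" 0 0] dV[of i j] by simp
    then show ?thesis by (simp add: pairing_def)
  next
    case False
    then obtain k l where kl: "outer u $ k $ l \<noteq> 0" by (auto simp: vec_eq_iff)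
    have "2 \<le> c" using rank1 outer_rank_le_1[of u] by simp
    have mv: "\<forall>\<^sub>F t in nhds 0. minors_vanish (\<gamma> t)"
      using ev by eventually_elim
        (use \<open>2 \<le> c\<close> in \<open>auto simp: corank_stratum_def corank_def intro!: rank_le_1_minors_vanish\<close>)
    have "deriv (\<lambda>t. \<gamma> t $ i $ j * \<gamma> t $ k $ l) 0 = deriv (\<lambda>t. \<gamma> t $ i $ l * \<gamma> t $ k $ j) 0" for i j
    proof (rule deriv_cong_ev[OF _ refl])
      show "\<forall>\<^sub>F t in nhds 0. \<gamma> t $ i $ j * \<gamma> t $ k $ l = \<gamma> t $ i $ l * \<gamma> t $ k $ j"
        using mv by (rule eventually_mono) (unfold minors_vanish_def, blast)
    qed
    moreover have "deriv (\<lambda>t. \<gamma> t $ i $ j * \<gamma> t $ k $ l) 0 = outer u $ i $ j * V $ k $ l + V $ i $ j * outer u $ k $ l" for i j k l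
      using DERIV_imp_deriv[OF DERIV_mult[OF der[of i j] der[of k l]]] by (simp add: \<gamma>0 mult_ac)
    ultimately have lin: "V $ i $ j * outer u $ k $ l =
        outer u $ i $ l * V $ k $ j + V $ i $ l * outer u $ k $ j - outer u $ i $ j * V $ k $ l" for i j
      by (simp add: algebra_simps)
    have Qu: "(\<Sum>j\<in>UNIV. Q $ i $ j * u $ j) = 0" for i
      using Q(2) by (simp add: vec_eq_iff matrix_vector_mult_def)
    have uQ: "(\<Sum>j\<in>UNIV. Q $ j $ i * u $ j) = 0" for i
    proof -
      have "Q $ j $ i = Q $ i $ j" for j using Q(1) unfolding Sym3_iff by blast
      then show ?thesis using Qu[of i] by simp
    qed
    \<comment> \<open>Multiplication by a nonzero entry of $u u^T$ allows the differentiated minors to be substituted.\<close>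
    have "pairing Q V * outer u $ k $ l = (\<Sum>i\<in>UNIV. \<Sum>j\<in>UNIV. Q $ i $ j * (V $ i $ j * outer u $ k $ l))"
      by (simp add: pairing_def sum_distrib_right mult.assoc)
    also have "\<dots> = 0"
      unfolding lin using Qu[of 1] Qu[of 2] Qu[of 3] uQ[of 1] uQ[of 2] uQ[of 3]
      by (simp add: outer_def sum_3) algebra
    finally show ?thesis using kl by simp
  qed
qed

text \<open>A nonzero matrix $R$ orthogonal to the subspace exists for the real inner product. Its entrywise
conjugate $Q$ has $\mathrm{Re} \langle Q, V \rangle = 0$ on the subspace; invariance under multiplication by the
imaginary unit makes the imaginary part vanish as well.\<close>

lemma proper_subspace_annihilator:
  assumes sub: "W \<subseteq> Sym3" "W \<noteq> Sym3" and zero: "0 \<in> W"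
    and add: "\<And>U V. U \<in> W \<Longrightarrow> V \<in> W \<Longrightarrow> U + V \<in> W"
    and scale: "\<And>c V. V \<in> W \<Longrightarrow> (\<chi> i j. c * V $ i $ j) \<in> W"
  obtains Q where "Q \<in> Sym3" "Q \<noteq> 0" "\<And>V. V \<in> W \<Longrightarrow> pairing Q V = 0"
proof -
  have sc: "c *\<^sub>R V = (\<chi> i j. of_real c * V $ i $ j)" for c and V :: "complex^3^3"
    unfolding vec_eq_iff by (simp add: scaleR_conv_of_real[where 'a = complex])
  have "subspace W"
    unfolding subspace_def sc using zero add scale by blast
  moreover have "subspace Sym3"
    unfolding subspace_def by (simp add: Sym3_iff)
  ultimately have "span W \<subset> span Sym3"
    using sub by (metis psubsetI span_eq_iff)
  then obtain R where R: "R \<noteq> 0" "R \<in> span Sym3" "\<And>V. V \<in> span W \<Longrightarrow> orthogonal R V"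
    using orthogonal_to_subspace_exists_gen by blast
  have "R \<in> Sym3" using R(2) \<open>subspace Sym3\<close> by (simp add: span_eq_iff[THEN iffD2])
  define Q where "Q = (\<chi> i j. cnj (R $ i $ j))"
  have inner: "inner R V = Re (pairing Q V)" for V
    by (simp add: inner_vec_def inner_complex_def pairing_def Q_def)
  have "Q \<in> Sym3" using \<open>R \<in> Sym3\<close> by (simp add: Sym3_iff Q_def)
  moreover have "Q \<noteq> 0" using \<open>R \<noteq> 0\<close> by (simp add: Q_def vec_eq_iff)
  moreover have "pairing Q V = 0" if V: "V \<in> W" for V
  proof -
    have re: "Re (pairing Q U) = 0" if "U \<in> W" for U
      using R(3)[of U] that inner[of U] by (simp add: orthogonal_def span_base)
    have "pairing Q (\<chi> i j. \<i> * V $ i $ j) = \<i> * pairing Q V"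
      by (simp add: pairing_def sum_distrib_left mult_ac)
    then show ?thesis
      using re[OF V] re[OF scale[OF V, of \<i>]] by (simp add: complex_eq_iff)
  qed
  ultimately show ?thesis using that by blast
qed

text \<open>Since $X$ is arbitrary, a matrix $Q$ orthogonal to all directions $XA + AX^T$ satisfies $AQ = 0$.\<close>

lemma pairing_congruence_direction:
  assumes "Q \<in> Sym3" "A \<in> Sym3"
  shows "pairing Q (X ** A + A ** transpose X) = 2 * (\<Sum>i\<in>UNIV. \<Sum>k\<in>UNIV. X $ i $ k * (A ** Q) $ k $ i)"
proof -
  have q: "Q $ 2 $ 1 = Q $ 1 $ 2" "Q $ 3 $ 1 = Q $ 1 $ 3" "Q $ 3 $ 2 = Q $ 2 $ 3"
    and a: "A $ 2 $ 1 = A $ 1 $ 2" "A $ 3 $ 1 = A $ 1 $ 3" "A $ 3 $ 2 = A $ 2 $ 3"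
    using assms unfolding Sym3_iff by blast+
  show ?thesis
    by (simp add: pairing_def matrix_matrix_mult_def transpose_def sum_3 q a algebra_simps)
qed

text \<open>If transversality fails, the span of the image of $dM$ and of the congruence directions is a proper
subspace. A matrix $Q$ orthogonal to it satisfies $A Q = 0$. By hypothesis $Q$ does not have rank one, so
the complementary matrix $A$ has rank at most one and equals $u u^T$. Conversely, such a $Q$ is orthogonal to the tangent
space of the stratum and to the image of $dM$, but not to its own conjugate.

Excluding rank one matrices $Q$ is what removes the corank one stratum from the criterion.\<close>

lemma not_transversal_iff:
  fixes M :: "complex^4 \<Rightarrow> complex^3^3"
  assumes sym: "\<And>v. M v \<in> Sym3" and Dsym: "\<And>v h. D v h \<in> Sym3"
    and der: "\<And>v. (M has_derivative D v) (at v)"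
    and lin: "\<And>v c h. D v (c *s h) = (\<chi> i j. c * D v h $ i $ j)"
    and no_rank_one: "\<And>v \<xi>. (\<And>h. pairing (outer \<xi>) (D v h) = 0) \<Longrightarrow> outer \<xi> = 0"
  shows "\<not> transversal_to_coranks M \<longleftrightarrow>
    (\<exists>v u Q. M v = outer u \<and> Q \<in> Sym3 \<and> Q \<noteq> 0 \<and> Q *v u = 0 \<and> (\<forall>h. pairing Q (D v h) = 0))"
    (is "_ \<longleftrightarrow> ?rhs")
proof -
  have fd: "frechet_derivative M (at v) = D v" for v
    using frechet_derivative_at[OF der] by simp
  define T where "T v c = {X + Y | X Y. X \<in> range (D v) \<and> Y \<in> tangent_space (corank_stratum c) (M v)}" for v c
  have nt: "\<not> transversal_to_coranks M \<longleftrightarrow> (\<exists>v. \<exists>c\<in>{1, 2, 3}. M v \<in> corank_stratum c \<and> T v c \<noteq> Sym3)"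
    unfolding transversal_to_coranks_def fd T_def by blast
  show ?thesis
  proof
    assume "\<not> transversal_to_coranks M"
    then obtain v c where c: "M v \<in> corank_stratum c" "T v c \<noteq> Sym3"
      using nt by blast
    let ?A = "M v"
    define W where "W = {D v h + (X ** ?A + ?A ** transpose X) | h X. True}"
    have "W \<subseteq> T v c"
      unfolding W_def T_def using congruence_directions_tangent[OF c(1)] by blast
    moreover have "T v c \<subseteq> Sym3"
      using Dsym tangent_space_subset_Sym3[of c ?A] unfolding T_def by (fastforce simp: Sym3_iff)
    ultimately have W: "W \<subseteq> Sym3" "W \<noteq> Sym3" using c(2) by auto
    have linD: "linear (D v)" using der by (rule has_derivative_linear)
    have WI: "D v h + (X ** ?A + ?A ** transpose X) \<in> W" for h X unfolding W_def by blast
    obtain Q where Q: "Q \<in> Sym3" "Q \<noteq> 0" "\<And>V. V \<in> W \<Longrightarrow> pairing Q V = 0"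
    proof (rule proper_subspace_annihilator[OF W])
      have "transpose 0 = (0 :: complex^3^3)" by (simp add: transpose_def vec_eq_iff)
      then show "0 \<in> W" using WI[of 0 0] linear_0[OF linD] by simp
    next
      fix U V assume "U \<in> W" "V \<in> W"
      then obtain h X h' X' where "U = D v h + (X ** ?A + ?A ** transpose X)"
        "V = D v h' + (X' ** ?A + ?A ** transpose X')" unfolding W_def by blast
      then have "U + V = D v (h + h') + ((X + X') ** ?A + ?A ** transpose (X + X'))"
        by (simp add: linear_add[OF linD] vec_eq_iff matrix_matrix_mult_def transpose_def
            sum.distrib algebra_simps)
      then show "U + V \<in> W" using WI by simp
    next
      fix k V assume "V \<in> W"
      then obtain h X where "V = D v h + (X ** ?A + ?A ** transpose X)" unfolding W_def by blast
      then have "(\<chi> i j. k * V $ i $ j) = D v (k *s h) + ((\<chi> i j. k * X $ i $ j) ** ?A + ?A ** transpose (\<chi> i j. k * X $ i $ j))"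
        by (simp add: lin vec_eq_iff matrix_matrix_mult_def transpose_def sum_distrib_left algebra_simps)
      then show "(\<chi> i j. k * V $ i $ j) \<in> W" using WI by simp
    qed blast
    have QD: "pairing Q (D v h) = 0" for h
    proof -
      have "transpose 0 = (0 :: complex^3^3)" by (simp add: transpose_def vec_eq_iff)
      then show ?thesis using Q(3)[OF WI[of h 0]] by simp
    qed
    have "(?A ** Q) $ k $ i = 0" for i k
    proof -
      \<comment> \<open>The elementary matrices isolate the entries of $A Q$.\<close>
      let ?X = "\<chi> p q. if p = i \<and> q = k then 1 else (0 :: complex)"
      have "pairing Q (?X ** ?A + ?A ** transpose ?X) = 0"
        using Q(3)[OF WI[of 0 ?X]] by (simp add: linear_0[OF linD])
      then have "(\<Sum>p\<in>UNIV. \<Sum>q\<in>UNIV. ?X $ p $ q * (?A ** Q) $ q $ p) = 0"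
        unfolding pairing_congruence_direction[OF Q(1) sym] by simp
      then show ?thesis
        using exhaust_3[of i] exhaust_3[of k] by (auto simp: sum_3)
    qed
    then have AQ: "?A ** Q = 0" by (simp add: vec_eq_iff)
    have "\<not> minors_vanish Q"
      using sym_minors_vanish_imp_outer[OF Q(1)] no_rank_one[of _ v] QD Q(2) by blast
    then obtain u where u: "?A = outer u"
      using complementary_minors_vanish[OF AQ] sym_minors_vanish_imp_outer[OF sym] by blast
    show ?rhs
    proof (cases "u = 0")
      case True
      then show ?thesis using u Q QD by (intro exI[of _ v] exI[of _ u] exI[of _ Q]) simp
    next
      case False
      then obtain k where k: "u $ k \<noteq> 0" by (auto simp: vec_eq_iff)
      have "(\<Sum>j\<in>UNIV. Q $ i $ j * u $ j) = 0" for i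
      proof -
        have "u $ k * (\<Sum>j\<in>UNIV. Q $ i $ j * u $ j) = (?A ** Q) $ k $ i"
          using Q(1) unfolding u matrix_matrix_mult_def outer_def Sym3_iff
          by (simp add: sum_distrib_left mult_ac)
        then show ?thesis using k by (simp add: AQ)
      qed
      then have "Q *v u = 0" by (simp add: matrix_vector_mult_def vec_eq_iff)
      then show ?thesis using u Q QD by blast
    qed
  next
    assume ?rhs
    then obtain v u Q where u: "M v = outer u" and Q: "Q \<in> Sym3" "Q \<noteq> 0" "Q *v u = 0"
      "\<And>h. pairing Q (D v h) = 0" by blast
    define c where "c = corank (outer u)"
    have mem: "outer u \<in> corank_stratum c"
      by (simp add: corank_stratum_def c_def outer_sym)
    have c: "c \<in> {1, 2, 3}"
      using outer_rank_le_1[of u] by (auto simp: c_def corank_def)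
    have "pairing Q V = 0" if V: "V \<in> T v c" for V
    proof -
      obtain h Y where "V = D v h + Y" "Y \<in> tangent_space (corank_stratum c) (outer u)"
        using V u unfolding T_def by auto
      then show ?thesis
        using pairing_tangent_rank_one[OF Q(1,3) _ mem] Q(4)[of h]
        by (simp add: pairing_def distrib_left sum.distrib)
    qed
    moreover have "(\<chi> i j. cnj (Q $ i $ j)) \<in> Sym3"
      using Q(1) by (simp add: Sym3_iff)
    \<comment> \<open>This pairing is the squared Euclidean norm of \<open>Q\<close>.\<close>
    moreover have "pairing Q (\<chi> i j. cnj (Q $ i $ j)) \<noteq> 0"
    proof
      assume "pairing Q (\<chi> i j. cnj (Q $ i $ j)) = 0"
      then have "Re (pairing Q (\<chi> i j. cnj (Q $ i $ j))) = 0" by simp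
      then have "inner Q Q = 0"
        by (simp add: pairing_def inner_vec_def inner_complex_def)
      then show False using Q(2) by simp
    qed
    ultimately have "T v c \<noteq> Sym3" by blast
    then show "\<not> transversal_to_coranks M"
      unfolding nt using c mem u by metis
  qed
qed

section \<open>Smoothness of zero levels\<close>

lemma not_smooth_scalar_iff:
  fixes f :: "complex^2 \<Rightarrow> complex"
  assumes "\<And>u. (f has_derivative (\<lambda>h. f1 u * h $ 1 + f2 u * h $ 2)) (at u)"
  shows "\<not> smooth_zero_level f \<longleftrightarrow> (\<exists>u. f u = 0 \<and> f1 u = 0 \<and> f2 u = 0)"
proof -
  have fd: "frechet_derivative f (at u) = (\<lambda>h. f1 u * h $ 1 + f2 u * h $ 2)" for u
    using frechet_derivative_at[OF assms] by simp
  have "surj (\<lambda>h :: complex^2. p * h $ 1 + q * h $ 2) \<longleftrightarrow> p \<noteq> 0 \<or> q \<noteq> 0" for p q :: complex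
  proof
    assume "surj (\<lambda>h :: complex^2. p * h $ 1 + q * h $ 2)"
    then obtain h :: "complex^2" where "1 = p * h $ 1 + q * h $ 2" by (rule surjE)
    then show "p \<noteq> 0 \<or> q \<noteq> 0" by auto
  next
    assume pq: "p \<noteq> 0 \<or> q \<noteq> 0"
    show "surj (\<lambda>h :: complex^2. p * h $ 1 + q * h $ 2)"
    proof (rule surjI)
      show "p * (vector [if p = 0 then 0 else y / p, if p = 0 then y / q else 0] :: complex^2) $ 1 +
            q * (vector [if p = 0 then 0 else y / p, if p = 0 then y / q else 0] :: complex^2) $ 2 = y" for y
        using pq by auto
    qed
  qed
  then show ?thesis by (auto simp: smooth_zero_level_def fd)
qed

lemma not_smooth_pair_iff:
  fixes G :: "complex^3 \<Rightarrow> complex^2"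
  assumes "\<And>u. (G has_derivative (\<lambda>h. J u *v h)) (at u)"
  shows "\<not> smooth_zero_level G \<longleftrightarrow>
    (\<exists>u r1 r2. G u = 0 \<and> (r1 \<noteq> 0 \<or> r2 \<noteq> 0) \<and> (\<forall>i. r1 * J u $ 1 $ i + r2 * J u $ 2 $ i = 0))"
proof -
  have fd: "frechet_derivative G (at u) = (*v) (J u)" for u
    using frechet_derivative_at[OF assms] by simp
  have "surj ((*v) A) \<longleftrightarrow>
     \<not> (\<exists>r1 r2. (r1 \<noteq> 0 \<or> r2 \<noteq> 0) \<and> (\<forall>i. r1 * A $ 1 $ i + r2 * A $ 2 $ i = 0))" for A :: "complex^3^2"
  proof -
    have "surj ((*v) A) \<longleftrightarrow> (\<forall>c. (\<Sum>i\<in>UNIV. c i *s row i A) = 0 \<longrightarrow> (\<forall>i. c i = 0))"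
      using matrix_right_invertible_surjective[of A] matrix_right_invertible_independent_rows[of A] by simp
    also have "\<dots> \<longleftrightarrow> (\<forall>c :: 2 \<Rightarrow> complex. (\<forall>i. c 1 * A $ 1 $ i + c 2 * A $ 2 $ i = 0) \<longrightarrow> c 1 = 0 \<and> c 2 = 0)"
      by (simp add: sum_2 forall_2 vec_eq_iff row_def)
    also have "\<dots> \<longleftrightarrow> (\<forall>r1 r2. (\<forall>i. r1 * A $ 1 $ i + r2 * A $ 2 $ i = 0) \<longrightarrow> r1 = 0 \<and> r2 = 0)"
    proof (intro iffI allI impI)
      fix r1 r2 assume a: "\<forall>c :: 2 \<Rightarrow> complex. (\<forall>i. c 1 * A $ 1 $ i + c 2 * A $ 2 $ i = 0) \<longrightarrow> c 1 = 0 \<and> c 2 = 0"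
        and b: "\<forall>i. r1 * A $ 1 $ i + r2 * A $ 2 $ i = 0"
      show "r1 = 0 \<and> r2 = 0"
        using a[rule_format, of "\<lambda>i. if i = 1 then r1 else r2"] b by auto
    qed blast
    finally show ?thesis by blast
  qed
  then show ?thesis by (auto simp: smooth_zero_level_def fd)
qed

text \<open>A surjective linear map reaches every zero of the original function and preserves the range of the
differential.\<close>

lemma smooth_zero_level_linear_change:
  fixes f :: "'a::real_normed_vector \<Rightarrow> 'b::real_normed_vector"
  assumes f: "\<And>u. f differentiable (at u)" and L: "bounded_linear L" "surj L"
  shows "smooth_zero_level (\<lambda>u. f (L u)) \<longleftrightarrow> smooth_zero_level f"
proof -
  have "((\<lambda>u. f (L u)) has_derivative (\<lambda>h. frechet_derivative f (at (L u)) (L h))) (at u)" for u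
    by (rule has_derivative_compose[OF bounded_linear_imp_has_derivative[OF L(1)]])
       (use f frechet_derivative_works in blast)
  then have "frechet_derivative (\<lambda>u. f (L u)) (at u) = (\<lambda>h. frechet_derivative f (at (L u)) (L h))" for u
    by (metis frechet_derivative_at)
  moreover have "range (\<lambda>h. D (L h)) = range D" for D :: "'a \<Rightarrow> 'b"
    using L(2) by (metis image_image)
  ultimately show ?thesis
    unfolding smooth_zero_level_def using L(2) by (metis surj_def)
qed

lemma has_derivative_scalar_compose:
  fixes p :: "complex \<Rightarrow> complex" and g :: "'a::real_normed_vector \<Rightarrow> complex"
  assumes "\<And>w. (p has_field_derivative p' w) (at w)" and "(g has_derivative g') (at u)"
  shows "((\<lambda>v. p (g v)) has_derivative (\<lambda>h. p' (g u) * g' h)) (at u)"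
  using has_derivative_compose[OF assms(2), of p "\<lambda>h. p' (g u) * h"] assms(1)[of "g u"]
  by (simp add: has_field_derivative_def)

section \<open>The triplets of type I\<close>

definition matrix_I :: "(complex \<Rightarrow> complex) \<Rightarrow> complex \<Rightarrow> complex^4 \<Rightarrow> complex^3^3" where
  "matrix_I P \<nu> v = vector [vector [v $ 1, \<nu>, v $ 3],
                             vector [\<nu>, v $ 2 + P (v $ 1), v $ 4],
                             vector [v $ 3, v $ 4, v $ 2]]"

definition curve_I :: "(complex \<Rightarrow> complex) \<Rightarrow> complex \<Rightarrow> complex^3 \<Rightarrow> complex^2" where
  "curve_I P \<nu> u = vector [2 * u $ 2 * u $ 3 + (u $ 3)\<^sup>2 + P ((u $ 1)\<^sup>2), u $ 1 * u $ 2 - \<nu>]"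

text \<open>Multiplying the first equation of the curve by $a$ and using $a b = \nu$ eliminates $b$ and gives this
function.\<close>

definition odd_I :: "(complex \<Rightarrow> complex) \<Rightarrow> complex \<Rightarrow> complex^2 \<Rightarrow> complex" where
  "odd_I P \<nu> u = u $ 1 * (u $ 2)\<^sup>2 + u $ 1 * P ((u $ 1)\<^sup>2) + 2 * \<nu> * u $ 2"

context
  fixes P P' :: "complex \<Rightarrow> complex" and \<nu> :: complex
  assumes P': "\<And>w. (P has_field_derivative P' w) (at w)"
begin

lemma curve_I_not_smooth_iff:
  "\<not> smooth_zero_level (curve_I P \<nu>) \<longleftrightarrow>
    (\<exists>a b c r1 r2. 2 * b * c + c\<^sup>2 + P (a\<^sup>2) = 0 \<and> a * b = \<nu> \<and> (r1 \<noteq> 0 \<or> r2 \<noteq> 0) \<and>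
       2 * r1 * a * P' (a\<^sup>2) + r2 * b = 0 \<and> 2 * r1 * c + r2 * a = 0 \<and> r1 * (b + c) = 0)"
proof -
  define J :: "complex^3 \<Rightarrow> complex^3^2" where
    "J u = vector [vector [P' ((u $ 1)\<^sup>2) * (2 * u $ 1), 2 * u $ 3, 2 * u $ 2 + 2 * u $ 3],
                   vector [u $ 2, u $ 1, 0]]" for u
  have sq: "((\<lambda>u :: complex^3. (u $ 1)\<^sup>2) has_derivative (\<lambda>h. 2 * u $ 1 * h $ 1)) (at u)" for u
    by (auto intro!: derivative_eq_intros)
  note Pc = has_derivative_scalar_compose[OF P' sq]
  have "(curve_I P \<nu> has_derivative (\<lambda>h. J u *v h)) (at u)" for u
  proof (rule has_derivative_vec_componentwise)
    fix i :: 2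
    have "((\<lambda>u. 2 * u $ 2 * u $ 3 + (u $ 3)\<^sup>2 + P ((u $ 1)\<^sup>2)) has_derivative (\<lambda>h. (J u *v h) $ 1)) (at u)"
      by (auto intro!: derivative_eq_intros Pc simp: J_def matrix_vector_mult_def sum_3 fun_eq_iff algebra_simps)
    moreover have "((\<lambda>u. u $ 1 * u $ 2 - \<nu>) has_derivative (\<lambda>h. (J u *v h) $ 2)) (at u)"
      by (auto intro!: derivative_eq_intros simp: J_def matrix_vector_mult_def sum_3 fun_eq_iff algebra_simps)
    ultimately show "((\<lambda>u. curve_I P \<nu> u $ i) has_derivative (\<lambda>h. (J u *v h) $ i)) (at u)"
      using exhaust_2[of i] by (auto simp: curve_I_def)
  qed
  note iff = not_smooth_pair_iff[of "curve_I P \<nu>", OF this]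
  have half: "r * (2 * b + 2 * c) = 0 \<longleftrightarrow> r * (b + c) = 0" for r b c :: complex
  proof -
    have "r * (2 * b + 2 * c) = 2 * (r * (b + c))" by (simp add: distrib_left)
    then show ?thesis by (simp only: mult_eq_0_iff) simp
  qed
  show ?thesis
  proof
    assume "\<not> smooth_zero_level (curve_I P \<nu>)"
    then obtain u r1 r2 where u: "curve_I P \<nu> u = 0" "r1 \<noteq> 0 \<or> r2 \<noteq> 0"
      "\<forall>i. r1 * J u $ 1 $ i + r2 * J u $ 2 $ i = 0" unfolding iff by blast
    have "r1 * (2 * u $ 2 + 2 * u $ 3) = 0" using u(3)[rule_format, of 3] by (simp add: J_def)
    then have third: "r1 * (u $ 2 + u $ 3) = 0" unfolding half .
    show "\<exists>a b c r1 r2. 2 * b * c + c\<^sup>2 + P (a\<^sup>2) = 0 \<and> a * b = \<nu> \<and> (r1 \<noteq> 0 \<or> r2 \<noteq> 0) \<and>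
       2 * r1 * a * P' (a\<^sup>2) + r2 * b = 0 \<and> 2 * r1 * c + r2 * a = 0 \<and> r1 * (b + c) = 0"
    proof (rule exI[of _ "u $ 1"], rule exI[of _ "u $ 2"], rule exI[of _ "u $ 3"], rule exI[of _ r1], rule exI[of _ r2],
        intro conjI third u(2))
      show "2 * r1 * u $ 1 * P' ((u $ 1)\<^sup>2) + r2 * u $ 2 = 0"
        using u(3)[rule_format, of 1] by (simp add: J_def mult_ac)
      show "2 * r1 * u $ 3 + r2 * u $ 1 = 0"
        using u(3)[rule_format, of 2] by (simp add: J_def mult_ac)
    qed (use u(1) in \<open>simp_all add: curve_I_def vec_eq_iff forall_2\<close>)
  next
    assume "\<exists>a b c r1 r2. 2 * b * c + c\<^sup>2 + P (a\<^sup>2) = 0 \<and> a * b = \<nu> \<and> (r1 \<noteq> 0 \<or> r2 \<noteq> 0) \<and>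
       2 * r1 * a * P' (a\<^sup>2) + r2 * b = 0 \<and> 2 * r1 * c + r2 * a = 0 \<and> r1 * (b + c) = 0"
    then obtain a b c r1 r2 where *: "2 * b * c + c\<^sup>2 + P (a\<^sup>2) = 0" "a * b = \<nu>" "r1 \<noteq> 0 \<or> r2 \<noteq> 0"
       "2 * r1 * a * P' (a\<^sup>2) + r2 * b = 0" "2 * r1 * c + r2 * a = 0" "r1 * (b + c) = 0"
      by blast
    have "r1 * (2 * b + 2 * c) = 0" using *(6) unfolding half .
    moreover have "r1 * (P' (a\<^sup>2) * (2 * a)) + r2 * b = 0" "r1 * (2 * c) + r2 * a = 0"
      using *(4,5) by algebra+
    ultimately show "\<not> smooth_zero_level (curve_I P \<nu>)" using *(1-3)
      unfolding iff
      by - (rule exI[of _ "vector [a, b, c]"], rule exI[of _ r1], rule exI[of _ r2],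
          simp add: curve_I_def J_def vec_eq_iff forall_2 forall_3)
  qed
qed

lemma odd_I_derivative:
  "(odd_I P \<nu> has_derivative
     (\<lambda>h. ((u $ 2)\<^sup>2 + P ((u $ 1)\<^sup>2) + 2 * (u $ 1)\<^sup>2 * P' ((u $ 1)\<^sup>2)) * h $ 1 +
          (2 * u $ 1 * u $ 2 + 2 * \<nu>) * h $ 2)) (at u)"
proof -
  have sq: "((\<lambda>u :: complex^2. (u $ 1)\<^sup>2) has_derivative (\<lambda>h. 2 * u $ 1 * h $ 1)) (at u)" for u
    by (auto intro!: derivative_eq_intros)
  note Pc = has_derivative_scalar_compose[OF P' sq]
  show ?thesis unfolding odd_I_def
    by (auto intro!: derivative_eq_intros Pc simp: fun_eq_iff) (simp add: algebra_simps power2_eq_square)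
qed

text \<open>For $a \neq 0$ a singular point of either curve has $b = -c$ and $P(a^2) = c^2$, and the remaining
conditions agree. A singular point with $a = 0$ exists if and only if $\nu = 0$: then the factor $a$ splits
off the plane curve, and its line $a = 0$ meets the other component at $c^2 = -P(0)$.\<close>

lemma odd_I_smooth_iff_curve_I_smooth:
  "smooth_zero_level (odd_I P \<nu>) \<longleftrightarrow> smooth_zero_level (curve_I P \<nu>)"
proof -
  note iff = not_smooth_scalar_iff[of "odd_I P \<nu>", OF odd_I_derivative]
  have "\<not> smooth_zero_level (odd_I P \<nu>) \<longleftrightarrow> \<not> smooth_zero_level (curve_I P \<nu>)"
    unfolding curve_I_not_smooth_iff
  proof
    assume "\<not> smooth_zero_level (odd_I P \<nu>)"
    then obtain u where u: "odd_I P \<nu> u = 0" "(u $ 2)\<^sup>2 + P ((u $ 1)\<^sup>2) + 2 * (u $ 1)\<^sup>2 * P' ((u $ 1)\<^sup>2) = 0"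
      "2 * u $ 1 * u $ 2 + 2 * \<nu> = 0" unfolding iff by blast
    define a c where "a = u $ 1" and "c = u $ 2"
    have F: "a * c\<^sup>2 + a * P (a\<^sup>2) + 2 * \<nu> * c = 0" and Fa: "c\<^sup>2 + P (a\<^sup>2) + 2 * a\<^sup>2 * P' (a\<^sup>2) = 0"
      and Fc: "2 * a * c + 2 * \<nu> = 0"
      using u by (simp_all add: odd_I_def a_def c_def)
    show "\<exists>a b c r1 r2. 2 * b * c + c\<^sup>2 + P (a\<^sup>2) = 0 \<and> a * b = \<nu> \<and> (r1 \<noteq> 0 \<or> r2 \<noteq> 0) \<and>
       2 * r1 * a * P' (a\<^sup>2) + r2 * b = 0 \<and> 2 * r1 * c + r2 * a = 0 \<and> r1 * (b + c) = 0"
    proof (cases "a = 0")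
      case True
      then show ?thesis using Fa Fc
        by - (rule exI[of _ 0], rule exI[of _ 0], rule exI[of _ c], rule exI[of _ 0], rule exI[of _ 1], simp)
    next
      case False
      have \<nu>: "a * (- c) = \<nu>" using Fc by algebra
      have "a * (P (a\<^sup>2) - c\<^sup>2) = 0" using F \<nu> by algebra
      then have Pc: "P (a\<^sup>2) = c\<^sup>2" using False by simp
      have 1: "2 * (- c) * c + c\<^sup>2 + P (a\<^sup>2) = 0" using Pc by algebra
      have 2: "2 * a * a * P' (a\<^sup>2) + (- 2 * c) * (- c) = 0" using Fa Pc by algebra
      have 3: "2 * a * c + (- 2 * c) * a = 0" "a * (- c + c) = 0" by algebra+
      show ?thesis
        by (rule exI[of _ a], rule exI[of _ "- c"], rule exI[of _ c], rule exI[of _ a], rule exI[of _ "- 2 * c"])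
           (intro conjI \<nu> 1 2 3 disjI1 False)
    qed
  next
    assume "\<exists>a b c r1 r2. 2 * b * c + c\<^sup>2 + P (a\<^sup>2) = 0 \<and> a * b = \<nu> \<and> (r1 \<noteq> 0 \<or> r2 \<noteq> 0) \<and>
       2 * r1 * a * P' (a\<^sup>2) + r2 * b = 0 \<and> 2 * r1 * c + r2 * a = 0 \<and> r1 * (b + c) = 0"
    then obtain a b c r1 r2 where G: "2 * b * c + c\<^sup>2 + P (a\<^sup>2) = 0" and \<nu>: "a * b = \<nu>" and r: "r1 \<noteq> 0 \<or> r2 \<noteq> 0"
       "2 * r1 * a * P' (a\<^sup>2) + r2 * b = 0" "2 * r1 * c + r2 * a = 0" "r1 * (b + c) = 0"
      by blast
    show "\<not> smooth_zero_level (odd_I P \<nu>)"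
    proof (cases "a = 0")
      case True
      \<comment> \<open>The second coordinate of a point where the line $a = 0$ meets the other component.\<close>
      define s where "s = csqrt (- P 0)"
      have "s\<^sup>2 = - P 0" unfolding s_def by (rule power2_csqrt)
      then show ?thesis
        unfolding iff using True \<nu> by (intro exI[of _ "vector [0, s]"]) (simp add: odd_I_def)
    next
      case False
      then have "r1 \<noteq> 0" using r by auto
      then have c: "c = - b" using r(4) by (simp add: add_eq_0_iff)
      have Pb: "P (a\<^sup>2) = b\<^sup>2" using G unfolding c by algebra
      have "r1 * (2 * b\<^sup>2 + 2 * a\<^sup>2 * P' (a\<^sup>2)) = 0"
        using r(2,3) unfolding c by algebra
      then have 1: "2 * b\<^sup>2 + 2 * a\<^sup>2 * P' (a\<^sup>2) = 0" using \<open>r1 \<noteq> 0\<close> by simp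
      have "(- b)\<^sup>2 + P (a\<^sup>2) + 2 * a\<^sup>2 * P' (a\<^sup>2) = 0" using 1 Pb by algebra
      moreover have "2 * a * (- b) + 2 * \<nu> = 0" by (simp flip: \<nu>)
      moreover have "a * (- b)\<^sup>2 + a * P (a\<^sup>2) + 2 * \<nu> * (- b) = 0" using Pb \<nu> by algebra
      ultimately show ?thesis
        unfolding iff odd_I_def by (intro exI[of _ "vector [a, - b]"] conjI) (simp_all only: vector_2)
    qed
  qed
  then show ?thesis by blast
qed

text \<open>A matrix of the family equal to $u u^T$ satisfies $u_1 u_2 = \nu$ and $u_2^2 - u_3^2 = P(u_1^2)$, which is the
curve with $u = (a, b, b + c)$. The matrices $Q$ orthogonal to the image of the differential form a
pencil, and $Q u$ is a combination of the gradients of the equations of the curve, with multipliers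
$r_1 = -Q_{22}/2$ and $r_2 = Q_{12}$.\<close>

lemma matrix_I_transversal_iff_curve_I_smooth:
  "transversal_to_coranks (matrix_I P \<nu>) \<longleftrightarrow> smooth_zero_level (curve_I P \<nu>)"
proof -
  define D where "D v h = (vector [vector [h $ 1, 0, h $ 3],
                             vector [0, h $ 2 + P' (v $ 1) * h $ 1, h $ 4],
                             vector [h $ 3, h $ 4, h $ 2]] :: complex^3^3)" for v h :: "complex^4"
  note Pc = has_derivative_scalar_compose[OF P' has_derivative_coordinate]
  have der: "(matrix_I P \<nu> has_derivative D v) (at v)" for v
  proof (intro has_derivative_vec_componentwise)
    fix i j :: 3
    show "((\<lambda>v. matrix_I P \<nu> v $ i $ j) has_derivative (\<lambda>h. D v h $ i $ j)) (at v)"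
      using exhaust_3[of i] exhaust_3[of j] unfolding matrix_I_def D_def
      by (elim disjE; simp only: vector_3; intro has_derivative_add Pc has_derivative_coordinate has_derivative_const)
  qed
  have kernel: "(\<forall>h. pairing Q (D v h) = 0) \<longleftrightarrow> Q $ 1 $ 1 + P' (v $ 1) * Q $ 2 $ 2 = 0 \<and> Q $ 2 $ 2 + Q $ 3 $ 3 = 0 \<and>
      Q $ 1 $ 3 = 0 \<and> Q $ 2 $ 3 = 0" (is "?l \<longleftrightarrow> ?r") if "Q \<in> Sym3" for Q v
  proof -
    have s: "Q $ 2 $ 1 = Q $ 1 $ 2" "Q $ 3 $ 1 = Q $ 1 $ 3" "Q $ 3 $ 2 = Q $ 2 $ 3"
      using that unfolding Sym3_iff by blast+
    have e: "pairing Q (D v h) = (Q $ 1 $ 1 + P' (v $ 1) * Q $ 2 $ 2) * h $ 1 + (Q $ 2 $ 2 + Q $ 3 $ 3) * h $ 2 +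
       2 * Q $ 1 $ 3 * h $ 3 + 2 * Q $ 2 $ 3 * h $ 4" for h
      by (simp add: pairing_def D_def sum_3 s algebra_simps)
    show ?thesis
    proof
      assume l: ?l
      show ?r
        using l[rule_format, of "axis 1 1"] l[rule_format, of "axis 2 1"]
          l[rule_format, of "axis 3 1"] l[rule_format, of "axis 4 1"]
        unfolding e by (simp add: axis_def)
    qed (simp add: e)
  qed
  have "\<not> transversal_to_coranks (matrix_I P \<nu>) \<longleftrightarrow>
    (\<exists>v u Q. matrix_I P \<nu> v = outer u \<and> Q \<in> Sym3 \<and> Q \<noteq> 0 \<and> Q *v u = 0 \<and> (\<forall>h. pairing Q (D v h) = 0))"
  proof (rule not_transversal_iff[OF _ _ der])
    show "matrix_I P \<nu> v \<in> Sym3" for v by (simp add: Sym3_iff forall_3 matrix_I_def)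
    show "D v h \<in> Sym3" for v h by (simp add: Sym3_iff forall_3 D_def)
    show "D v (c *s h) = (\<chi> i j. c * D v h $ i $ j)" for v c h
      by (simp add: vec_eq_iff forall_3 D_def algebra_simps)
    fix v \<xi> assume "\<And>h. pairing (outer \<xi>) (D v h) = 0"
    then have "outer \<xi> $ 1 $ 1 + P' (v $ 1) * outer \<xi> $ 2 $ 2 = 0 \<and> outer \<xi> $ 2 $ 2 + outer \<xi> $ 3 $ 3 = 0 \<and>
      outer \<xi> $ 1 $ 3 = 0 \<and> outer \<xi> $ 2 $ 3 = 0"
      using kernel[OF outer_sym] by blast
    then have "\<xi> = 0" by (auto simp: outer_def vec_eq_iff forall_3)
    then show "outer \<xi> = 0" by (simp add: outer_def vec_eq_iff)
  qed
  also have "\<dots> \<longleftrightarrow> \<not> smooth_zero_level (curve_I P \<nu>)"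
    unfolding curve_I_not_smooth_iff
  proof
    assume "\<exists>v u Q. matrix_I P \<nu> v = outer u \<and> Q \<in> Sym3 \<and> Q \<noteq> 0 \<and> Q *v u = 0 \<and> (\<forall>h. pairing Q (D v h) = 0)"
    then obtain v u Q where M: "matrix_I P \<nu> v = outer u" and Q: "Q \<in> Sym3" "Q \<noteq> 0" "Q *v u = 0"
      and k: "\<forall>h. pairing Q (D v h) = 0" by blast
    have s: "Q $ 2 $ 1 = Q $ 1 $ 2" "Q $ 3 $ 1 = Q $ 1 $ 3" "Q $ 3 $ 2 = Q $ 2 $ 3"
      using Q(1) unfolding Sym3_iff by blast+
    have m: "u $ 1 * u $ 2 = \<nu>" "v $ 2 + P (v $ 1) = (u $ 2)\<^sup>2" "v $ 2 = (u $ 3)\<^sup>2" "v $ 1 = (u $ 1)\<^sup>2"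
      using M by (auto simp: matrix_I_def outer_def vec_eq_iff forall_3 power2_eq_square)
    have k': "Q $ 1 $ 1 = - P' (v $ 1) * Q $ 2 $ 2" "Q $ 3 $ 3 = - Q $ 2 $ 2" "Q $ 1 $ 3 = 0" "Q $ 2 $ 3 = 0"
      using k unfolding kernel[OF Q(1)] by (elim conjE, algebra)+
    have Qu: "- P' ((u $ 1)\<^sup>2) * Q $ 2 $ 2 * u $ 1 + Q $ 1 $ 2 * u $ 2 = 0"
      "Q $ 1 $ 2 * u $ 1 + Q $ 2 $ 2 * u $ 2 = 0" "Q $ 2 $ 2 * u $ 3 = 0"
      using Q(3) unfolding m(4)[symmetric] by (auto simp: matrix_vector_mult_def vec_eq_iff forall_3 sum_3 s k')
    have nz: "- Q $ 2 $ 2 / 2 \<noteq> 0 \<or> Q $ 1 $ 2 \<noteq> 0"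
    proof (rule ccontr)
      assume "\<not> ?thesis"
      then have "Q $ 2 $ 2 = 0" "Q $ 1 $ 2 = 0" by auto
      then have "Q = 0" by (simp add: vec_eq_iff forall_3 s k')
      then show False using Q(2) by simp
    qed
    show "\<exists>a b c r1 r2. 2 * b * c + c\<^sup>2 + P (a\<^sup>2) = 0 \<and> a * b = \<nu> \<and> (r1 \<noteq> 0 \<or> r2 \<noteq> 0) \<and>
       2 * r1 * a * P' (a\<^sup>2) + r2 * b = 0 \<and> 2 * r1 * c + r2 * a = 0 \<and> r1 * (b + c) = 0"
    proof (rule exI[of _ "u $ 1"], rule exI[of _ "u $ 2"], rule exI[of _ "u $ 3 - u $ 2"],
        rule exI[of _ "- Q $ 2 $ 2 / 2"], rule exI[of _ "Q $ 1 $ 2"], intro conjI nz m(1))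
      show "2 * u $ 2 * (u $ 3 - u $ 2) + (u $ 3 - u $ 2)\<^sup>2 + P ((u $ 1)\<^sup>2) = 0"
        using m(2) unfolding m(3,4) by algebra
      show "2 * (- Q $ 2 $ 2 / 2) * u $ 1 * P' ((u $ 1)\<^sup>2) + Q $ 1 $ 2 * u $ 2 = 0"
        using Qu(1) by (simp add: mult_ac)
      show "2 * (- Q $ 2 $ 2 / 2) * (u $ 3 - u $ 2) + Q $ 1 $ 2 * u $ 1 = 0"
        using Qu(2,3) by (simp add: algebra_simps)
      show "- Q $ 2 $ 2 / 2 * (u $ 2 + (u $ 3 - u $ 2)) = 0"
        using Qu(3) by simp
    qed
  next
    assume "\<exists>a b c r1 r2. 2 * b * c + c\<^sup>2 + P (a\<^sup>2) = 0 \<and> a * b = \<nu> \<and> (r1 \<noteq> 0 \<or> r2 \<noteq> 0) \<and>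
       2 * r1 * a * P' (a\<^sup>2) + r2 * b = 0 \<and> 2 * r1 * c + r2 * a = 0 \<and> r1 * (b + c) = 0"
    then obtain a b c r1 r2 where G: "2 * b * c + c\<^sup>2 + P (a\<^sup>2) = 0" and \<nu>: "a * b = \<nu>" and r: "r1 \<noteq> 0 \<or> r2 \<noteq> 0"
       "2 * r1 * a * P' (a\<^sup>2) + r2 * b = 0" "2 * r1 * c + r2 * a = 0" "r1 * (b + c) = 0"
      by blast
    \<comment> \<open>The point of the source at which the family takes the value $u u^T$ with $u = (a, b, b + c)$.\<close>
    define v :: "complex^4" where "v = (\<chi> i. if i = 1 then a\<^sup>2 else if i = 2 then (b + c)\<^sup>2
        else if i = 3 then a * (b + c) else b * (b + c))"
    have v: "v $ 1 = a\<^sup>2" "v $ 2 = (b + c)\<^sup>2" "v $ 3 = a * (b + c)" "v $ 4 = b * (b + c)" by (simp_all add: v_def)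
    define Q :: "complex^3^3" where "Q = vector [vector [2 * r1 * P' (a\<^sup>2), r2, 0], vector [r2, - 2 * r1, 0],
        vector [0, 0, 2 * r1]]"
    have Qs: "Q \<in> Sym3" by (simp add: Sym3_iff forall_3 Q_def)
    show "\<exists>v u Q. matrix_I P \<nu> v = outer u \<and> Q \<in> Sym3 \<and> Q \<noteq> 0 \<and> Q *v u = 0 \<and> (\<forall>h. pairing Q (D v h) = 0)"
    proof (rule exI[of _ v], rule exI[of _ "vector [a, b, b + c]"], rule exI[of _ Q], intro conjI Qs)
      have "(b + c)\<^sup>2 + P (a\<^sup>2) = b * b" using G by algebra
      then show "matrix_I P \<nu> v = outer (vector [a, b, b + c])"
        using \<nu> by (simp add: matrix_I_def outer_def v vec_eq_iff forall_3 mult.commute)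
           (simp add: power2_eq_square)
      show "Q \<noteq> 0" using r(1) by (auto simp: Q_def vec_eq_iff forall_3)
      have 1: "2 * r1 * P' (a\<^sup>2) * a + r2 * b = 0" using r(2) by algebra
      have 2: "r2 * a + - 2 * r1 * b = 0" using r(3,4) by algebra
      show "Q *v vector [a, b, b + c] = 0"
        using 1 2 r(4) by (simp add: Q_def matrix_vector_mult_def vec_eq_iff forall_3 sum_3)
      show "\<forall>h. pairing Q (D v h) = 0"
        unfolding kernel[OF Qs] by (simp add: Q_def v)
    qed
  qed
  finally show ?thesis by blast
qed

end

section \<open>The triplets of type II\<close>

text \<open>The polynomials of the three families enter the comparison only through their derivatives, so $p$ and $q$
are arbitrary entire functions here.\<close>

definition matrix_II :: "(complex \<Rightarrow> complex) \<Rightarrow> (complex \<Rightarrow> complex) \<Rightarrow> complex^4 \<Rightarrow> complex^3^3" where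
  "matrix_II p q v = vector [vector [v $ 1, p (v $ 4), v $ 2 + q (v $ 4)],
                             vector [p (v $ 4), v $ 2, v $ 3],
                             vector [v $ 2 + q (v $ 4), v $ 3, v $ 4]]"

definition curve_II :: "(complex \<Rightarrow> complex) \<Rightarrow> (complex \<Rightarrow> complex) \<Rightarrow> complex^3 \<Rightarrow> complex^2" where
  "curve_II p q u = vector [- u $ 1 * u $ 3 + (u $ 2)\<^sup>2 + q ((u $ 3)\<^sup>2), u $ 1 * u $ 2 - p ((u $ 3)\<^sup>2)]"

text \<open>Eliminating $a$ from the equations of the curve: $b (a c) - c (a b)$ expressed through $p$ and $q$.\<close>

definition odd_II :: "(complex \<Rightarrow> complex) \<Rightarrow> (complex \<Rightarrow> complex) \<Rightarrow> complex^2 \<Rightarrow> complex" where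
  "odd_II p q u = (u $ 1) ^ 3 + u $ 1 * q ((u $ 2)\<^sup>2) - u $ 2 * p ((u $ 2)\<^sup>2)"

context
  fixes p q p' q' :: "complex \<Rightarrow> complex"
  assumes p': "\<And>w. (p has_field_derivative p' w) (at w)"
    and q': "\<And>w. (q has_field_derivative q' w) (at w)"
begin

lemma curve_II_not_smooth_iff:
  "\<not> smooth_zero_level (curve_II p q) \<longleftrightarrow>
    (\<exists>a b c r1 r2. a * c = b\<^sup>2 + q (c\<^sup>2) \<and> a * b = p (c\<^sup>2) \<and> (r1 \<noteq> 0 \<or> r2 \<noteq> 0) \<and>
       r2 * b = r1 * c \<and> r2 * a + 2 * r1 * b = 0 \<and> r1 * (2 * c * q' (c\<^sup>2) - a) = 2 * r2 * c * p' (c\<^sup>2))"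
proof -
  define J :: "complex^3 \<Rightarrow> complex^3^2" where
    "J u = vector [vector [- u $ 3, 2 * u $ 2, - u $ 1 + q' ((u $ 3)\<^sup>2) * (2 * u $ 3)],
                   vector [u $ 2, u $ 1, - p' ((u $ 3)\<^sup>2) * (2 * u $ 3)]]" for u
  have sq: "((\<lambda>u :: complex^3. (u $ 3)\<^sup>2) has_derivative (\<lambda>h. 2 * u $ 3 * h $ 3)) (at u)" for u
    by (auto intro!: derivative_eq_intros)
  note pc = has_derivative_scalar_compose[OF p' sq] and qc = has_derivative_scalar_compose[OF q' sq]
  have "(curve_II p q has_derivative (\<lambda>h. J u *v h)) (at u)" for u
  proof (rule has_derivative_vec_componentwise)
    fix i :: 2
    have "((\<lambda>u. - u $ 1 * u $ 3 + (u $ 2)\<^sup>2 + q ((u $ 3)\<^sup>2)) has_derivative (\<lambda>h. (J u *v h) $ 1)) (at u)"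
      by (auto intro!: derivative_eq_intros qc simp: J_def matrix_vector_mult_def sum_3 fun_eq_iff algebra_simps)
    moreover have "((\<lambda>u. u $ 1 * u $ 2 - p ((u $ 3)\<^sup>2)) has_derivative (\<lambda>h. (J u *v h) $ 2)) (at u)"
      by (auto intro!: derivative_eq_intros pc simp: J_def matrix_vector_mult_def sum_3 fun_eq_iff algebra_simps)
    ultimately show "((\<lambda>u. curve_II p q u $ i) has_derivative (\<lambda>h. (J u *v h) $ i)) (at u)"
      using exhaust_2[of i] by (auto simp: curve_II_def)
  qed
  note iff = not_smooth_pair_iff[of "curve_II p q", OF this]
  show ?thesis
  proof
    assume "\<not> smooth_zero_level (curve_II p q)"
    then obtain u r1 r2 where u: "curve_II p q u = 0" "r1 \<noteq> 0 \<or> r2 \<noteq> 0"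
      "\<forall>i. r1 * J u $ 1 $ i + r2 * J u $ 2 $ i = 0" unfolding iff by blast
    show "\<exists>a b c r1 r2. a * c = b\<^sup>2 + q (c\<^sup>2) \<and> a * b = p (c\<^sup>2) \<and> (r1 \<noteq> 0 \<or> r2 \<noteq> 0) \<and>
       r2 * b = r1 * c \<and> r2 * a + 2 * r1 * b = 0 \<and> r1 * (2 * c * q' (c\<^sup>2) - a) = 2 * r2 * c * p' (c\<^sup>2)"
      by (rule exI[of _ "u $ 1"], rule exI[of _ "u $ 2"], rule exI[of _ "u $ 3"], rule exI[of _ r1], rule exI[of _ r2])
         (use u in \<open>auto simp: curve_II_def J_def vec_eq_iff forall_2 forall_3 algebra_simps\<close>)
  next
    assume "\<exists>a b c r1 r2. a * c = b\<^sup>2 + q (c\<^sup>2) \<and> a * b = p (c\<^sup>2) \<and> (r1 \<noteq> 0 \<or> r2 \<noteq> 0) \<and>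
       r2 * b = r1 * c \<and> r2 * a + 2 * r1 * b = 0 \<and> r1 * (2 * c * q' (c\<^sup>2) - a) = 2 * r2 * c * p' (c\<^sup>2)"
    then obtain a b c r1 r2 where *: "a * c = b\<^sup>2 + q (c\<^sup>2)" "a * b = p (c\<^sup>2)" "r1 \<noteq> 0 \<or> r2 \<noteq> 0"
       "r2 * b = r1 * c" "r2 * a + 2 * r1 * b = 0" "r1 * (2 * c * q' (c\<^sup>2) - a) = 2 * r2 * c * p' (c\<^sup>2)"
      by blast
    show "\<not> smooth_zero_level (curve_II p q)"
      unfolding iff
      by (rule exI[of _ "vector [a, b, c]"], rule exI[of _ r1], rule exI[of _ r2])
         (use * in \<open>auto simp: curve_II_def J_def vec_eq_iff forall_2 forall_3 algebra_simps\<close>)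
  qed
qed

lemma odd_II_derivative:
  "(odd_II p q has_derivative
     (\<lambda>h. (3 * (u $ 1)\<^sup>2 + q ((u $ 2)\<^sup>2)) * h $ 1 +
          (2 * u $ 1 * u $ 2 * q' ((u $ 2)\<^sup>2) - p ((u $ 2)\<^sup>2) - 2 * (u $ 2)\<^sup>2 * p' ((u $ 2)\<^sup>2)) * h $ 2)) (at u)"
proof -
  have sq: "((\<lambda>u :: complex^2. (u $ 2)\<^sup>2) has_derivative (\<lambda>h. 2 * u $ 2 * h $ 2)) (at u)" for u
    by (auto intro!: derivative_eq_intros)
  note pc = has_derivative_scalar_compose[OF p' sq] and qc = has_derivative_scalar_compose[OF q' sq]
  show ?thesis unfolding odd_II_def
    by (auto intro!: derivative_eq_intros pc qc simp: fun_eq_iff) (simp add: algebra_simps power2_eq_square)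
qed

text \<open>For $c \neq 0$ put $a = (b^2 + q)/c$ and use the multipliers $(r_1, r_2) = (b, c)$. At $c = 0$ both curves are
singular only at the origin, and this happens if and only if $p(0) = q(0) = 0$.\<close>

lemma odd_II_smooth_iff_curve_II_smooth:
  "smooth_zero_level (odd_II p q) \<longleftrightarrow> smooth_zero_level (curve_II p q)"
proof -
  have "\<not> smooth_zero_level (odd_II p q) \<longleftrightarrow> (\<exists>b c. b ^ 3 + b * q (c\<^sup>2) - c * p (c\<^sup>2) = 0 \<and>
      3 * b\<^sup>2 + q (c\<^sup>2) = 0 \<and> 2 * b * c * q' (c\<^sup>2) - p (c\<^sup>2) - 2 * c\<^sup>2 * p' (c\<^sup>2) = 0)" (is "_ \<longleftrightarrow> ?odd")
  proof
    assume ?odd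
    then obtain b c where "b ^ 3 + b * q (c\<^sup>2) - c * p (c\<^sup>2) = 0" "3 * b\<^sup>2 + q (c\<^sup>2) = 0"
      "2 * b * c * q' (c\<^sup>2) - p (c\<^sup>2) - 2 * c\<^sup>2 * p' (c\<^sup>2) = 0" by blast
    then show "\<not> smooth_zero_level (odd_II p q)"
      unfolding not_smooth_scalar_iff[of "odd_II p q", OF odd_II_derivative] odd_II_def
      by (intro exI[of _ "vector [b, c]"]) simp
  qed (unfold not_smooth_scalar_iff[of "odd_II p q", OF odd_II_derivative] odd_II_def, blast)
  also have "?odd \<longleftrightarrow> \<not> smooth_zero_level (curve_II p q)"
    unfolding curve_II_not_smooth_iff
  proof
    assume ?odd
    then obtain b c where F: "b ^ 3 + b * q (c\<^sup>2) - c * p (c\<^sup>2) = 0" and Fb: "3 * b\<^sup>2 + q (c\<^sup>2) = 0"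
      and Fc: "2 * b * c * q' (c\<^sup>2) - p (c\<^sup>2) - 2 * c\<^sup>2 * p' (c\<^sup>2) = 0" by blast
    show "\<exists>a b c r1 r2. a * c = b\<^sup>2 + q (c\<^sup>2) \<and> a * b = p (c\<^sup>2) \<and> (r1 \<noteq> 0 \<or> r2 \<noteq> 0) \<and>
       r2 * b = r1 * c \<and> r2 * a + 2 * r1 * b = 0 \<and> r1 * (2 * c * q' (c\<^sup>2) - a) = 2 * r2 * c * p' (c\<^sup>2)"
    proof (cases "c = 0")
      case True
      then have "b * b\<^sup>2 = 0" using F Fb by algebra
      then have "b = 0" by simp
      then show ?thesis using True Fb Fc
        by - (rule exI[of _ 0], rule exI[of _ 0], rule exI[of _ 0], rule exI[of _ 1], rule exI[of _ 0], simp)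
    next
      case False
      define a where "a = (b\<^sup>2 + q (c\<^sup>2)) / c"
      have ac: "a * c = b\<^sup>2 + q (c\<^sup>2)" using False by (simp add: a_def)
      have "(a * b - p (c\<^sup>2)) * c = 0" using F ac by algebra
      then have ab: "a * b = p (c\<^sup>2)" using False by simp
      have 1: "c * a + 2 * b * b = 0" using ac Fb by algebra
      have 2: "b * (2 * c * q' (c\<^sup>2) - a) = 2 * c * c * p' (c\<^sup>2)" using Fc ab by algebra
      show ?thesis
        by (rule exI[of _ a], rule exI[of _ b], rule exI[of _ c], rule exI[of _ b], rule exI[of _ c])
           (intro conjI ac ab 1 2 disjI2 False mult.commute)
    qed
  next
    assume "\<exists>a b c r1 r2. a * c = b\<^sup>2 + q (c\<^sup>2) \<and> a * b = p (c\<^sup>2) \<and> (r1 \<noteq> 0 \<or> r2 \<noteq> 0) \<and>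
       r2 * b = r1 * c \<and> r2 * a + 2 * r1 * b = 0 \<and> r1 * (2 * c * q' (c\<^sup>2) - a) = 2 * r2 * c * p' (c\<^sup>2)"
    then obtain a b c r1 r2 where ac: "a * c = b\<^sup>2 + q (c\<^sup>2)" and ab: "a * b = p (c\<^sup>2)"
      and r: "r1 \<noteq> 0 \<or> r2 \<noteq> 0" "r2 * b = r1 * c" "r2 * a + 2 * r1 * b = 0"
      "r1 * (2 * c * q' (c\<^sup>2) - a) = 2 * r2 * c * p' (c\<^sup>2)" by blast
    have F: "b ^ 3 + b * q (c\<^sup>2) - c * p (c\<^sup>2) = 0" using ac ab by algebra
    show ?odd
    proof (cases "c = 0")
      case True
      have "b = 0"
      proof (rule ccontr)
        assume "b \<noteq> 0"
        then show False using r True by auto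
      qed
      then show ?thesis using True ac ab by - (rule exI[of _ 0], rule exI[of _ 0], simp)
    next
      case False
      then have "r2 \<noteq> 0" using r by auto
      have "r2 * (2 * b\<^sup>2 + a * c) = 0" using r(2,3) by algebra
      then have "2 * b\<^sup>2 + a * c = 0" using \<open>r2 \<noteq> 0\<close> by simp
      then have 1: "3 * b\<^sup>2 + q (c\<^sup>2) = 0" using ac by algebra
      have "r2 * (2 * b * c * q' (c\<^sup>2) - p (c\<^sup>2) - 2 * c\<^sup>2 * p' (c\<^sup>2)) = 0"
        using r(2,4) ab by algebra
      then show ?thesis using F 1 \<open>r2 \<noteq> 0\<close> by auto
    qed
  qed
  finally show ?thesis by blast
qed

text \<open>The bottom right block of a matrix $u u^T$ in the family recovers $y = b^2$, $z = b c$, $w = c^2$ from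
$u = (a, b, c)$, and the other entries are the equations of the curve. The pencil of matrices orthogonal
to the image of the differential is parametrised by the multipliers $r_1 = -Q_{13}$, $r_2 = Q_{12}$, so that
$Q u$ is the combination of the gradients of the equations of the curve.\<close>

lemma matrix_II_transversal_iff_curve_II_smooth:
  "transversal_to_coranks (matrix_II p q) \<longleftrightarrow> smooth_zero_level (curve_II p q)"
proof -
  define D where "D v h = (vector [vector [h $ 1, p' (v $ 4) * h $ 4, h $ 2 + q' (v $ 4) * h $ 4],
                             vector [p' (v $ 4) * h $ 4, h $ 2, h $ 3],
                             vector [h $ 2 + q' (v $ 4) * h $ 4, h $ 3, h $ 4]] :: complex^3^3)" for v h :: "complex^4"
  note pc = has_derivative_scalar_compose[OF p' has_derivative_coordinate]
    and qc = has_derivative_scalar_compose[OF q' has_derivative_coordinate]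
  have der: "(matrix_II p q has_derivative D v) (at v)" for v
  proof (intro has_derivative_vec_componentwise)
    fix i j :: 3
    show "((\<lambda>v. matrix_II p q v $ i $ j) has_derivative (\<lambda>h. D v h $ i $ j)) (at v)"
      using exhaust_3[of i] exhaust_3[of j] unfolding matrix_II_def D_def
      by (elim disjE; simp only: vector_3; intro has_derivative_add pc qc has_derivative_coordinate)
  qed
  have kernel: "(\<forall>h. pairing Q (D v h) = 0) \<longleftrightarrow> Q $ 1 $ 1 = 0 \<and> Q $ 2 $ 2 + 2 * Q $ 1 $ 3 = 0 \<and> Q $ 2 $ 3 = 0 \<and>
      Q $ 3 $ 3 + 2 * p' (v $ 4) * Q $ 1 $ 2 + 2 * q' (v $ 4) * Q $ 1 $ 3 = 0" (is "?l \<longleftrightarrow> ?r") if "Q \<in> Sym3" for Q v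
  proof -
    have s: "Q $ 2 $ 1 = Q $ 1 $ 2" "Q $ 3 $ 1 = Q $ 1 $ 3" "Q $ 3 $ 2 = Q $ 2 $ 3"
      using that unfolding Sym3_iff by blast+
    have e: "pairing Q (D v h) = Q $ 1 $ 1 * h $ 1 + (Q $ 2 $ 2 + 2 * Q $ 1 $ 3) * h $ 2 + 2 * Q $ 2 $ 3 * h $ 3 +
       (Q $ 3 $ 3 + 2 * p' (v $ 4) * Q $ 1 $ 2 + 2 * q' (v $ 4) * Q $ 1 $ 3) * h $ 4" for h
      by (simp add: pairing_def D_def sum_3 s algebra_simps)
    show ?thesis
    proof
      assume l: ?l
      show ?r
        using l[rule_format, of "axis 1 1"] l[rule_format, of "axis 2 1"]
          l[rule_format, of "axis 3 1"] l[rule_format, of "axis 4 1"]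
        unfolding e by (simp add: axis_def)
    qed (simp add: e)
  qed
  have "\<not> transversal_to_coranks (matrix_II p q) \<longleftrightarrow>
    (\<exists>v u Q. matrix_II p q v = outer u \<and> Q \<in> Sym3 \<and> Q \<noteq> 0 \<and> Q *v u = 0 \<and> (\<forall>h. pairing Q (D v h) = 0))"
  proof (rule not_transversal_iff[OF _ _ der])
    show "matrix_II p q v \<in> Sym3" for v by (simp add: Sym3_iff forall_3 matrix_II_def)
    show "D v h \<in> Sym3" for v h by (simp add: Sym3_iff forall_3 D_def)
    show "D v (c *s h) = (\<chi> i j. c * D v h $ i $ j)" for v c h
      by (simp add: vec_eq_iff forall_3 D_def algebra_simps)
    fix v \<xi> assume "\<And>h. pairing (outer \<xi>) (D v h) = 0"
    then have "outer \<xi> $ 1 $ 1 = 0 \<and> outer \<xi> $ 2 $ 2 + 2 * outer \<xi> $ 1 $ 3 = 0 \<and> outer \<xi> $ 2 $ 3 = 0 \<and>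
      outer \<xi> $ 3 $ 3 + 2 * p' (v $ 4) * outer \<xi> $ 1 $ 2 + 2 * q' (v $ 4) * outer \<xi> $ 1 $ 3 = 0"
      using kernel[OF outer_sym] by blast
    then have "\<xi> = 0" by (auto simp: outer_def vec_eq_iff forall_3)
    then show "outer \<xi> = 0" by (simp add: outer_def vec_eq_iff)
  qed
  also have "\<dots> \<longleftrightarrow> \<not> smooth_zero_level (curve_II p q)"
    unfolding curve_II_not_smooth_iff
  proof
    assume "\<exists>v u Q. matrix_II p q v = outer u \<and> Q \<in> Sym3 \<and> Q \<noteq> 0 \<and> Q *v u = 0 \<and> (\<forall>h. pairing Q (D v h) = 0)"
    then obtain v u Q where M: "matrix_II p q v = outer u" and Q: "Q \<in> Sym3" "Q \<noteq> 0" "Q *v u = 0"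
      and k: "\<forall>h. pairing Q (D v h) = 0" by blast
    have s: "Q $ 2 $ 1 = Q $ 1 $ 2" "Q $ 3 $ 1 = Q $ 1 $ 3" "Q $ 3 $ 2 = Q $ 2 $ 3"
      using Q(1) unfolding Sym3_iff by blast+
    have m: "u $ 1 * u $ 2 = p (v $ 4)" "v $ 2 + q (v $ 4) = u $ 1 * u $ 3" "v $ 2 = (u $ 2)\<^sup>2" "v $ 4 = (u $ 3)\<^sup>2"
      using M by (auto simp: matrix_II_def outer_def vec_eq_iff forall_3 power2_eq_square)
    have k': "Q $ 1 $ 1 = 0" "Q $ 2 $ 2 = - 2 * Q $ 1 $ 3" "Q $ 2 $ 3 = 0"
      "Q $ 3 $ 3 = - 2 * p' (v $ 4) * Q $ 1 $ 2 - 2 * q' (v $ 4) * Q $ 1 $ 3"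
      using k unfolding kernel[OF Q(1)] by (elim conjE, algebra)+
    have Qu: "Q $ 1 $ 2 * u $ 2 + Q $ 1 $ 3 * u $ 3 = 0" "Q $ 1 $ 2 * u $ 1 - 2 * Q $ 1 $ 3 * u $ 2 = 0"
      "Q $ 1 $ 3 * u $ 1 + Q $ 3 $ 3 * u $ 3 = 0"
      using Q(3) by (auto simp: matrix_vector_mult_def vec_eq_iff forall_3 sum_3 s k')
    have nz: "- Q $ 1 $ 3 \<noteq> 0 \<or> Q $ 1 $ 2 \<noteq> 0"
    proof (rule ccontr)
      assume "\<not> ?thesis"
      then have "Q $ 1 $ 3 = 0" "Q $ 1 $ 2 = 0" by auto
      then have "Q = 0" by (simp add: vec_eq_iff forall_3 s k')
      then show False using Q(2) by simp
    qed
    show "\<exists>a b c r1 r2. a * c = b\<^sup>2 + q (c\<^sup>2) \<and> a * b = p (c\<^sup>2) \<and> (r1 \<noteq> 0 \<or> r2 \<noteq> 0) \<and>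
       r2 * b = r1 * c \<and> r2 * a + 2 * r1 * b = 0 \<and> r1 * (2 * c * q' (c\<^sup>2) - a) = 2 * r2 * c * p' (c\<^sup>2)"
    proof (rule exI[of _ "u $ 1"], rule exI[of _ "u $ 2"], rule exI[of _ "u $ 3"],
        rule exI[of _ "- Q $ 1 $ 3"], rule exI[of _ "Q $ 1 $ 2"], intro conjI nz)
      show "u $ 1 * u $ 3 = (u $ 2)\<^sup>2 + q ((u $ 3)\<^sup>2)" "u $ 1 * u $ 2 = p ((u $ 3)\<^sup>2)"
        using m by auto
      show "Q $ 1 $ 2 * u $ 2 = - Q $ 1 $ 3 * u $ 3" "Q $ 1 $ 2 * u $ 1 + 2 * - Q $ 1 $ 3 * u $ 2 = 0"
        using Qu by algebra+
      show "- Q $ 1 $ 3 * (2 * u $ 3 * q' ((u $ 3)\<^sup>2) - u $ 1) = 2 * Q $ 1 $ 2 * u $ 3 * p' ((u $ 3)\<^sup>2)"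
        using Qu(3) k'(4) unfolding m(4) by algebra
    qed
  next
    assume "\<exists>a b c r1 r2. a * c = b\<^sup>2 + q (c\<^sup>2) \<and> a * b = p (c\<^sup>2) \<and> (r1 \<noteq> 0 \<or> r2 \<noteq> 0) \<and>
       r2 * b = r1 * c \<and> r2 * a + 2 * r1 * b = 0 \<and> r1 * (2 * c * q' (c\<^sup>2) - a) = 2 * r2 * c * p' (c\<^sup>2)"
    then obtain a b c r1 r2 where ac: "a * c = b\<^sup>2 + q (c\<^sup>2)" and ab: "a * b = p (c\<^sup>2)"
      and r: "r1 \<noteq> 0 \<or> r2 \<noteq> 0" "r2 * b = r1 * c" "r2 * a + 2 * r1 * b = 0"
      "r1 * (2 * c * q' (c\<^sup>2) - a) = 2 * r2 * c * p' (c\<^sup>2)" by blast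
    \<comment> \<open>The point of the source at which the family takes the value $u u^T$ with $u = (a, b, c)$.\<close>
    define v :: "complex^4" where "v = (\<chi> i. if i = 1 then a\<^sup>2 else if i = 2 then b\<^sup>2 else if i = 3 then b * c else c\<^sup>2)"
    have v: "v $ 1 = a\<^sup>2" "v $ 2 = b\<^sup>2" "v $ 3 = b * c" "v $ 4 = c\<^sup>2" by (simp_all add: v_def)
    define Q :: "complex^3^3" where "Q = vector [vector [0, r2, - r1], vector [r2, 2 * r1, 0],
        vector [- r1, 0, - 2 * p' (c\<^sup>2) * r2 + 2 * q' (c\<^sup>2) * r1]]"
    have Qs: "Q \<in> Sym3" by (simp add: Sym3_iff forall_3 Q_def)
    show "\<exists>v u Q. matrix_II p q v = outer u \<and> Q \<in> Sym3 \<and> Q \<noteq> 0 \<and> Q *v u = 0 \<and> (\<forall>h. pairing Q (D v h) = 0)"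
    proof (rule exI[of _ v], rule exI[of _ "vector [a, b, c]"], rule exI[of _ Q], intro conjI Qs)
      show "matrix_II p q v = outer (vector [a, b, c])"
        using ac ab by (simp add: matrix_II_def outer_def v vec_eq_iff forall_3 power2_eq_square mult.commute)
      show "Q \<noteq> 0" using r(1) by (auto simp: Q_def vec_eq_iff forall_3)
      show "Q *v vector [a, b, c] = 0"
        using r(2-4) by (simp add: Q_def matrix_vector_mult_def vec_eq_iff forall_3 sum_3 algebra_simps)
      show "\<forall>h. pairing Q (D v h) = 0"
        unfolding kernel[OF Qs] by (simp add: Q_def v)
    qed
  qed
  finally show ?thesis by blast
qed

end

section \<open>The biholomorphisms of the bases\<close>

lemma P_I_deriv: "\<exists>d. \<forall>w. (P_I k l has_field_derivative d w) (at w)"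
proof -
  have "(P_I k l has_field_derivative (of_nat k * w ^ (k - 1) + (\<Sum>i<k. l i * (of_nat i * w ^ (i - 1))))) (at w)" for w
    unfolding P_I_def by (auto intro!: derivative_eq_intros sum.cong simp: mult_ac)
  show ?thesis by (rule exI, rule allI, fact)
qed

lemma p_II_deriv: "\<exists>d. \<forall>w. (p_II s l has_field_derivative d w) (at w)"
proof (cases s)
  case II4
  have "(p_II s l has_field_derivative (2 * w + l 1)) (at w)" for w
    unfolding II4 p_II.simps[abs_def] by (auto intro!: derivative_eq_intros)
  show ?thesis by (rule exI, rule allI, fact)
next
  case II5
  have "(p_II s l has_field_derivative (2 * l 2 * w + l 1)) (at w)" for w
    unfolding II5 p_II.simps[abs_def] by (auto intro!: derivative_eq_intros)
  show ?thesis by (rule exI, rule allI, fact)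
next
  case II6
  have "(p_II s l has_field_derivative (3 * w\<^sup>2 + 2 * l 2 * w + l 1)) (at w)" for w
    unfolding II6 p_II.simps[abs_def] by (auto intro!: derivative_eq_intros)
  show ?thesis by (rule exI, rule allI, fact)
qed

lemma q_II_deriv: "\<exists>d. \<forall>w. (q_II s l has_field_derivative d w) (at w)"
proof (cases s)
  case II4
  have "(q_II s l has_field_derivative (l 3)) (at w)" for w
    unfolding II4 q_II.simps[abs_def] by (auto intro!: derivative_eq_intros)
  show ?thesis by (rule exI, rule allI, fact)
next
  case II5
  have "(q_II s l has_field_derivative (2 * w + l 4)) (at w)" for w
    unfolding II5 q_II.simps[abs_def] by (auto intro!: derivative_eq_intros)
  show ?thesis by (rule exI, rule allI, fact)
next
  case II6
  have "(q_II s l has_field_derivative (2 * l 5 * w + l 4)) (at w)" for w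
    unfolding II6 q_II.simps[abs_def] by (auto intro!: derivative_eq_intros)
  show ?thesis by (rule exI, rule allI, fact)
qed

lemma families_as_normal_forms:
  "matrix_family (Type_I k) l = matrix_I (P_I k l) (l k)"
  "curve_family (Type_I k) l = curve_I (P_I k l) (l k)"
  "matrix_family (Type_II s) l = matrix_II (p_II s l) (q_II s l)"
  "curve_family (Type_II s) l = curve_II (p_II s l) (q_II s l)"
  by (simp_all add: fun_eq_iff Let_def matrix_I_def curve_I_def matrix_II_def curve_II_def)

lemma matrix_bifurcation_eq_curve_bifurcation:
  "matrix_bifurcation T idx = curve_bifurcation T idx"
proof -
  have "transversal_to_coranks (matrix_family T l) \<longleftrightarrow> smooth_zero_level (curve_family T l)" for l
  proof (cases T)
    case (Type_I k)
    obtain d where "\<And>w. (P_I k l has_field_derivative d w) (at w)" using P_I_deriv by blast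
    then show ?thesis
      unfolding Type_I families_as_normal_forms by (rule matrix_I_transversal_iff_curve_I_smooth)
  next
    case (Type_II s)
    obtain d e where "\<And>w. (p_II s l has_field_derivative d w) (at w)"
      "\<And>w. (q_II s l has_field_derivative e w) (at w)" using p_II_deriv q_II_deriv by metis
    then show ?thesis
      unfolding Type_II families_as_normal_forms by (rule matrix_II_transversal_iff_curve_II_smooth)
  qed
  then show ?thesis by (simp add: matrix_bifurcation_def curve_bifurcation_def)
qed

definition odd_deformation :: "triplet \<Rightarrow> (nat \<times> nat) set \<Rightarrow> (nat \<times> nat \<Rightarrow> complex) \<Rightarrow> complex^2 \<Rightarrow> complex" where
  "odd_deformation T S \<mu> u = odd_function T u + (\<Sum>m\<in>S. \<mu> m * monom2 m u)"

text \<open>Transfers a change of parameters $\varphi$ with inverse $\psi$, written for sequences of coefficients and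
families indexed by monomials, to the coordinate spaces labelled by \<open>idx\<close> and \<open>mon\<close>. The conditions \<open>local\<close>
express that only the coordinates that exist in these spaces matter; the conditions \<open>hol\<close> hold for
every $\varphi$ and $\psi$ built from polynomial expressions.\<close>

lemma biholomorphic_pairs_by_coordinate_change:
  fixes idx :: "nat \<Rightarrow> 'n::finite" and mon :: "'m::finite \<Rightarrow> nat \<times> nat"
    and \<phi> :: "(nat \<Rightarrow> complex) \<Rightarrow> nat \<times> nat \<Rightarrow> complex" and \<psi> :: "(nat \<times> nat \<Rightarrow> complex) \<Rightarrow> nat \<Rightarrow> complex"
  assumes idx: "bij_betw idx {..<tau T} UNIV" and mon: "bij_betw mon UNIV S"
    and local: "\<And>l l' m. m \<in> S \<Longrightarrow> (\<And>i. i < tau T \<Longrightarrow> l i = l' i) \<Longrightarrow> \<phi> l m = \<phi> l' m"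
      "\<And>\<mu> \<mu>' i. i < tau T \<Longrightarrow> (\<And>m. m \<in> S \<Longrightarrow> \<mu> m = \<mu>' m) \<Longrightarrow> \<psi> \<mu> i = \<psi> \<mu>' i"
    and inverse: "\<And>l i. i < tau T \<Longrightarrow> \<psi> (\<phi> l) i = l i" "\<And>\<mu> m. m \<in> S \<Longrightarrow> \<phi> (\<psi> \<mu>) m = \<mu> m"
    and hol: "\<And>X m (x :: complex^'n). m \<in> S \<Longrightarrow> (\<And>i. complex_diff_at (X i) x) \<Longrightarrow>
        complex_diff_at (\<lambda>y. \<phi> (\<lambda>i. X i y) m) x"
      "\<And>X i (x :: complex^'m). i < tau T \<Longrightarrow> (\<And>m. complex_diff_at (X m) x) \<Longrightarrow>
        complex_diff_at (\<lambda>y. \<psi> (\<lambda>m. X m y) i) x"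
    and singular: "\<And>l. smooth_zero_level (odd_deformation T S (\<phi> l)) \<longleftrightarrow> smooth_zero_level (curve_family T l)"
  shows "biholomorphic_pairs (curve_bifurcation T idx) (odd_bifurcation T mon)"
proof -
  define pos where "pos = the_inv_into {..<tau T} idx"
  define ind where "ind = the_inv_into UNIV mon"
  have pos: "pos j < tau T" "idx (pos j) = j" for j
    using idx by (auto simp: pos_def bij_betw_def intro: f_the_inv_into_f dest: the_inv_into_into[where x = j and B = "{..<tau T}"])
  have pos': "pos (idx i) = i" if "i < tau T" for i
    using idx that by (auto simp: pos_def bij_betw_def intro: the_inv_into_f_f)
  have ind: "ind (mon j) = j" for j
    using mon by (auto simp: ind_def bij_betw_def intro: the_inv_into_f_f)
  have ind': "mon (ind m) = m" if "m \<in> S" for m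
    using mon that by (auto simp: ind_def bij_betw_def intro: f_the_inv_into_f)
  have monS: "mon j \<in> S" for j using mon by (auto simp: bij_betw_def)
  define \<Phi> :: "complex^'n \<Rightarrow> complex^'m" where "\<Phi> l = (\<chi> j. \<phi> (\<lambda>i. l $ idx i) (mon j))" for l
  define \<Psi> :: "complex^'m \<Rightarrow> complex^'n" where "\<Psi> \<mu> = (\<chi> j. \<psi> (\<lambda>m. \<mu> $ ind m) (pos j))" for \<mu>
  have \<Psi>\<Phi>: "\<Psi> (\<Phi> l) = l" for l
  proof -
    have "\<Psi> (\<Phi> l) $ j = l $ j" for j
    proof -
      have "\<Psi> (\<Phi> l) $ j = \<psi> (\<lambda>m. \<phi> (\<lambda>i. l $ idx i) (mon (ind m))) (pos j)"
        by (simp add: \<Psi>_def \<Phi>_def)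
      also have "\<dots> = \<psi> (\<phi> (\<lambda>i. l $ idx i)) (pos j)"
        by (rule local(2)[OF pos(1)]) (simp add: ind')
      also have "\<dots> = l $ j" using inverse(1)[OF pos(1)] by (simp add: pos)
      finally show ?thesis .
    qed
    then show ?thesis by (simp add: vec_eq_iff)
  qed
  have \<Phi>\<Psi>: "\<Phi> (\<Psi> \<mu>) = \<mu>" for \<mu>
  proof -
    have "\<Phi> (\<Psi> \<mu>) $ j = \<mu> $ j" for j
    proof -
      have "\<Phi> (\<Psi> \<mu>) $ j = \<phi> (\<lambda>i. \<psi> (\<lambda>m. \<mu> $ ind m) (pos (idx i))) (mon j)"
        by (simp add: \<Psi>_def \<Phi>_def)
      also have "\<dots> = \<phi> (\<psi> (\<lambda>m. \<mu> $ ind m)) (mon j)"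
        by (rule local(1)[OF monS]) (simp add: pos')
      also have "\<dots> = \<mu> $ j" using inverse(2)[OF monS] by (simp add: ind)
      finally show ?thesis .
    qed
    then show ?thesis by (simp add: vec_eq_iff)
  qed
  have bij: "bij \<Phi>" by (rule o_bij[of \<Psi>]) (simp_all add: fun_eq_iff \<Psi>\<Phi> \<Phi>\<Psi>)
  have inv: "inv \<Phi> = \<Psi>" by (rule inv_unique_comp) (simp_all add: fun_eq_iff \<Psi>\<Phi> \<Phi>\<Psi>)
  have "holomorphic_map \<Phi>"
    unfolding holomorphic_map_def \<Phi>_def vec_lambda_beta
    by (intro allI hol(1)[OF monS] complex_diff_at_nth)
  moreover have "holomorphic_map \<Psi>"
    unfolding holomorphic_map_def \<Psi>_def vec_lambda_beta
    by (intro allI hol(2)[OF pos(1)] complex_diff_at_nth)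
  ultimately have "biholomorphism \<Phi>"
    using bij by (simp add: biholomorphism_def inv)
  moreover have "\<Phi> ` curve_bifurcation T idx = odd_bifurcation T mon"
  proof -
    have "\<Phi> l \<in> odd_bifurcation T mon \<longleftrightarrow> l \<in> curve_bifurcation T idx" for l
    proof -
      have "(\<Sum>j\<in>UNIV. \<Phi> l $ j * monom2 (mon j) u) = (\<Sum>m\<in>S. \<phi> (\<lambda>i. l $ idx i) m * monom2 m u)" for u
        unfolding \<Phi>_def vec_lambda_beta by (rule sum.reindex_bij_betw[OF mon])
      then have "(\<lambda>u. odd_function T u + (\<Sum>j\<in>UNIV. \<Phi> l $ j * monom2 (mon j) u)) =
          odd_deformation T S (\<phi> (\<lambda>i. l $ idx i))"
        by (simp add: fun_eq_iff odd_deformation_def)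
      then show ?thesis
        using singular by (simp add: odd_bifurcation_def curve_bifurcation_def)
    qed
    then show ?thesis by (auto simp: image_iff) (metis \<Phi>\<Psi>)
  qed
  ultimately show ?thesis by (auto simp: biholomorphic_pairs_def)
qed

lemma odd_II_differentiable: "odd_II (p_II s l) (q_II s l) differentiable (at u)"
  using odd_II_derivative[of "p_II s l" _ "q_II s l"] p_II_deriv[of s l] q_II_deriv[of s l]
  unfolding differentiable_def by blast

lemma odd_II_linear_change_smooth_iff:
  assumes "bounded_linear L" "surj L" and f: "\<And>u. f u = odd_II (p_II s l) (q_II s l) (L u)"
  shows "smooth_zero_level f \<longleftrightarrow> smooth_zero_level (curve_family (Type_II s) l)"
proof -
  have "f = (\<lambda>u. odd_II (p_II s l) (q_II s l) (L u))" using f by blast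
  then have "smooth_zero_level f \<longleftrightarrow> smooth_zero_level (odd_II (p_II s l) (q_II s l))"
    using smooth_zero_level_linear_change[OF odd_II_differentiable assms(1,2)] by simp
  also have "\<dots> \<longleftrightarrow> smooth_zero_level (curve_family (Type_II s) l)"
    unfolding families_as_normal_forms
    using odd_II_smooth_iff_curve_II_smooth p_II_deriv[of s l] q_II_deriv[of s l] by blast
  finally show ?thesis .
qed

lemma shear_scaling:
  fixes \<kappa> \<zeta> :: complex
  assumes "\<zeta> \<noteq> 0"
  shows "bounded_linear (\<lambda>u :: complex^2. vector [u $ 1 + \<kappa> * u $ 2, \<zeta> * u $ 2] :: complex^2)"
    and "surj (\<lambda>u :: complex^2. vector [u $ 1 + \<kappa> * u $ 2, \<zeta> * u $ 2] :: complex^2)"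
proof -
  show "bounded_linear (\<lambda>u :: complex^2. vector [u $ 1 + \<kappa> * u $ 2, \<zeta> * u $ 2] :: complex^2)"
    by (rule linear_conv_bounded_linear[THEN iffD1], rule linearI)
       (simp_all add: vec_eq_iff forall_2 algebra_simps)
  show "surj (\<lambda>u :: complex^2. vector [u $ 1 + \<kappa> * u $ 2, \<zeta> * u $ 2] :: complex^2)"
    by (rule surjI[where f = "\<lambda>v. vector [v $ 1 - \<kappa> * (v $ 2 / \<zeta>), v $ 2 / \<zeta>]"])
       (use assms in \<open>simp add: vec_eq_iff forall_2\<close>)
qed

text \<open>Here the function obtained by elimination is already the odd deformation, with $2 \lambda_k$ as the
coefficient of $c$.\<close>

lemma curve_odd_pairs_type_I:
  fixes idx :: "nat \<Rightarrow> 'n::finite" and mon :: "'m::finite \<Rightarrow> nat \<times> nat"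
  assumes "1 \<le> k" "bij_betw idx {..<tau (Type_I k)} UNIV"
    and "monomial_R_miniversal (odd_function (Type_I k)) B" "bij_betw mon UNIV (odd_monomials B)"
  shows "biholomorphic_pairs (curve_bifurcation (Type_I k) idx) (odd_bifurcation (Type_I k) mon)"
proof (rule biholomorphic_pairs_by_coordinate_change[OF assms(2,4)])
  note S = odd_monomials_I[OF assms(3,1)]
  define \<phi> :: "(nat \<Rightarrow> complex) \<Rightarrow> nat \<times> nat \<Rightarrow> complex" where
    "\<phi> l m = (if m = (0, 1) then 2 * l k else l (fst m div 2))" for l m
  define \<psi> :: "(nat \<times> nat \<Rightarrow> complex) \<Rightarrow> nat \<Rightarrow> complex" where
    "\<psi> \<mu> i = (if i = k then \<mu> (0, 1) / 2 else \<mu> (2 * i + 1, 0))" for \<mu> i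
  show "\<phi> l m = \<phi> l' m" if "m \<in> odd_monomials B" "\<And>i. i < tau (Type_I k) \<Longrightarrow> l i = l' i" for l l' m
    using that unfolding S by (auto simp: \<phi>_def)
  show "\<psi> \<mu> i = \<psi> \<mu>' i" if "i < tau (Type_I k)" "\<And>m. m \<in> odd_monomials B \<Longrightarrow> \<mu> m = \<mu>' m" for \<mu> \<mu>' i
    using that unfolding S by (auto simp: \<psi>_def)
  show "\<psi> (\<phi> l) i = l i" if "i < tau (Type_I k)" for l i
    using that by (auto simp: \<phi>_def \<psi>_def)
  show "\<phi> (\<psi> \<mu>) m = \<mu> m" if "m \<in> odd_monomials B" for \<mu> m
    using that unfolding S by (auto simp: \<phi>_def \<psi>_def)
  show "complex_diff_at (\<lambda>y. \<phi> (\<lambda>i. X i y) m) x"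
    if "\<And>i. complex_diff_at (X i) x" for X m and x :: "complex^'n"
    unfolding \<phi>_def using that by (cases "m = (0, 1)") (auto intro: complex_diff_at_intros)
  show "complex_diff_at (\<lambda>y. \<psi> (\<lambda>m. X m y) i) x"
    if "\<And>m. complex_diff_at (X m) x" for X i and x :: "complex^'m"
    unfolding \<psi>_def using that by (cases "i = k") (auto intro: complex_diff_at_intros)
  fix l
  obtain d where d: "\<And>w. (P_I k l has_field_derivative d w) (at w)" using P_I_deriv by blast
  have "odd_deformation (Type_I k) (odd_monomials B) (\<phi> l) = odd_I (P_I k l) (l k)"
  proof
    fix u
    have inj: "inj_on (\<lambda>i. (Suc (2 * i), 0 :: nat)) {..<k}" by (auto simp: inj_on_def)
    have "(\<Sum>m\<in>odd_monomials B. \<phi> l m * monom2 m u) =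
        2 * l k * u $ 2 + (\<Sum>i<k. l i * (u $ 1) ^ (2 * i + 1))"
      unfolding S by (subst sum.insert) (auto simp: sum.reindex[OF inj] \<phi>_def monom2_def)
    also have "(\<Sum>i<k. l i * (u $ 1) ^ (2 * i + 1)) = u $ 1 * (\<Sum>i<k. l i * ((u $ 1)\<^sup>2) ^ i)"
      by (simp add: sum_distrib_left mult_ac flip: power_mult)
    finally show "odd_deformation (Type_I k) (odd_monomials B) (\<phi> l) u = odd_I (P_I k l) (l k) u"
      by (simp add: odd_deformation_def odd_I_def P_I_def Let_def algebra_simps flip: power_mult)
  qed
  then show "smooth_zero_level (odd_deformation (Type_I k) (odd_monomials B) (\<phi> l)) \<longleftrightarrow>
      smooth_zero_level (curve_family (Type_I k) l)"
    unfolding families_as_normal_forms using odd_I_smooth_iff_curve_I_smooth[OF d] by simp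
qed

text \<open>The reflection $c \mapsto -c$ turns $b^3 + b q - c p$ into the odd deformation; $p$ has the coefficients of the
odd powers of $c$, and $q$ those of $b c^{2i}$.\<close>

lemma curve_odd_pairs_type_II_cusp:
  fixes idx :: "nat \<Rightarrow> 'n::finite" and mon :: "'m::finite \<Rightarrow> nat \<times> nat" and d :: nat
  assumes s: "s = II4 \<and> d = 2 \<or> s = II6 \<and> d = 3" and idx: "bij_betw idx {..<tau (Type_II s)} UNIV"
    and mini: "monomial_R_miniversal (odd_function (Type_II s)) B" and mon: "bij_betw mon UNIV (odd_monomials B)"
  shows "biholomorphic_pairs (curve_bifurcation (Type_II s) idx) (odd_bifurcation (Type_II s) mon)"
proof (rule biholomorphic_pairs_by_coordinate_change[OF idx mon])
  have tau: "tau (Type_II s) = 2 * d" using s by auto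
  have f: "odd_function (Type_II s) = (\<lambda>u. (u $ 1) ^ 3 + (u $ 2) ^ (2 * d + 1))"
    using s by (auto simp: fun_eq_iff Let_def eval_nat_numeral)
  have "odd_monomials B = {(i, j). i \<le> 1 \<and> j < 2 * d + 1 - 1 \<and> odd (i + j)}"
    by (rule odd_monomials_cubic_plus_power[OF f _ mini]) (use s in auto)
  also have "\<dots> = (\<lambda>i. if i < d then (0, 2 * i + 1) else (1, 2 * (i - d))) ` {..<2 * d}" (is "_ = ?R")
  proof (intro set_eqI iffI)
    fix m :: "nat \<times> nat" assume "m \<in> {(i, j). i \<le> 1 \<and> j < 2 * d + 1 - 1 \<and> odd (i + j)}"
    then obtain i j where m: "m = (i, j)" "i \<le> 1" "j < 2 * d" "odd (i + j)" by auto
    show "m \<in> ?R"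
    proof (cases "i = 0")
      case True
      then obtain r where "j = 2 * r + 1" using m by (auto elim: oddE)
      then show ?thesis using m True by (intro image_eqI[of _ _ r]) auto
    next
      case False
      then have "i = 1" "even j" using m by auto
      then obtain r where "j = 2 * r" by (auto elim: evenE)
      then show ?thesis using m \<open>i = 1\<close> by (intro image_eqI[of _ _ "d + r"]) auto
    qed
  qed (auto split: if_splits)
  finally have S: "odd_monomials B = ?R" .
  define \<phi> :: "(nat \<Rightarrow> complex) \<Rightarrow> nat \<times> nat \<Rightarrow> complex" where
    "\<phi> l m = l (if fst m = 0 then snd m div 2 else d + snd m div 2)" for l m
  define \<psi> :: "(nat \<times> nat \<Rightarrow> complex) \<Rightarrow> nat \<Rightarrow> complex" where
    "\<psi> \<mu> i = \<mu> (if i < d then (0, 2 * i + 1) else (1, 2 * (i - d)))" for \<mu> i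
  show "\<phi> l m = \<phi> l' m" if "m \<in> odd_monomials B" "\<And>i. i < tau (Type_II s) \<Longrightarrow> l i = l' i" for l l' m
    using that unfolding S tau by (auto simp: \<phi>_def split: if_splits)
  show "\<psi> \<mu> i = \<psi> \<mu>' i" if "i < tau (Type_II s)" "\<And>m. m \<in> odd_monomials B \<Longrightarrow> \<mu> m = \<mu>' m" for \<mu> \<mu>' i
    unfolding \<psi>_def by (rule that(2)) (use that(1) in \<open>auto simp: S tau\<close>)
  show "\<psi> (\<phi> l) i = l i" if "i < tau (Type_II s)" for l i
    using that by (auto simp: \<phi>_def \<psi>_def)
  show "\<phi> (\<psi> \<mu>) m = \<mu> m" if "m \<in> odd_monomials B" for \<mu> m
    using that unfolding S by (auto simp: \<phi>_def \<psi>_def split: if_splits)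
  show "complex_diff_at (\<lambda>y. \<phi> (\<lambda>i. X i y) m) x"
    if "\<And>i. complex_diff_at (X i) x" for X m and x :: "complex^'n"
    unfolding \<phi>_def by (rule that)
  show "complex_diff_at (\<lambda>y. \<psi> (\<lambda>m. X m y) i) x"
    if "\<And>m. complex_diff_at (X m) x" for X i and x :: "complex^'m"
    unfolding \<psi>_def by (rule that)
  fix l
  let ?L = "\<lambda>u :: complex^2. vector [u $ 1 + 0 * u $ 2, - 1 * u $ 2] :: complex^2"
  show "smooth_zero_level (odd_deformation (Type_II s) (odd_monomials B) (\<phi> l)) \<longleftrightarrow>
      smooth_zero_level (curve_family (Type_II s) l)"
  proof (rule odd_II_linear_change_smooth_iff[where L = ?L])
    show "bounded_linear ?L" "surj ?L" by (rule shear_scaling; simp)+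
    fix u :: "complex^2"
    have inj: "inj_on (\<lambda>i. if i < d then (0, 2 * i + 1) else (1 :: nat, 2 * (i - d))) {..<2 * d}"
      by (auto simp: inj_on_def split: if_splits)
    have "(\<Sum>m\<in>odd_monomials B. \<phi> l m * monom2 m u) =
       (\<Sum>i<2 * d. l i * monom2 (if i < d then (0, 2 * i + 1) else (1, 2 * (i - d))) u)"
      unfolding S by (subst sum.reindex[OF inj]) (auto simp: \<phi>_def intro!: sum.cong)
    also have "odd_function (Type_II s) u + \<dots> = odd_II (p_II s l) (q_II s l) (?L u)"
      using s by (elim disjE conjE)
        (simp_all add: odd_II_def monom2_def Let_def eval_nat_numeral algebra_simps)
    finally show "odd_deformation (Type_II s) (odd_monomials B) (\<phi> l) u = odd_II (p_II s l) (q_II s l) (?L u)"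
      unfolding odd_deformation_def .
  qed
qed

text \<open>With $\zeta^4 = -1$, replacing $c$ by $\zeta c$ turns $b^3 + b q - c p$ into $b^3 - b c^4 + \zeta \lambda_2 c^5 + \dots$, which is the
odd deformation if $c^5$ is the basis monomial. If it is $b^2 c$, the shear $b \mapsto b + \zeta \lambda_2 c$
in addition removes $c^5$ and creates $3 \zeta \lambda_2 b^2 c$; the other coefficients then change by
polynomials in $\lambda_2$, and the correspondence is triangular.\<close>

lemma curve_odd_pairs_type_II5:
  fixes idx :: "nat \<Rightarrow> 'n::finite" and mon :: "'m::finite \<Rightarrow> nat \<times> nat"
  assumes idx: "bij_betw idx {..<tau (Type_II II5)} UNIV"
    and mini: "monomial_R_miniversal (odd_function (Type_II II5)) B" and mon: "bij_betw mon UNIV (odd_monomials B)"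
  shows "biholomorphic_pairs (curve_bifurcation (Type_II II5) idx) (odd_bifurcation (Type_II II5) mon)"
proof -
  obtain e where e: "e = (0, 5) \<or> e = (2, 1)" and S: "odd_monomials B = {(0, 1), (0, 3), (1, 0), (1, 2), e}"
    using odd_monomials_II5[OF mini] .
  define \<zeta> where "\<zeta> = csqrt \<i>"
  have \<zeta>2: "\<zeta> * \<zeta> = \<i>" using power2_csqrt[of \<i>] unfolding \<zeta>_def power2_eq_square .
  then have \<zeta>0: "\<zeta> \<noteq> 0" by auto
  \<comment> \<open>The slope of the shear, in units of $\lambda_2$; there is no shear for the basis monomial $c^5$.\<close>
  define t :: complex where "t = (if e = (0, 5) then 0 else \<zeta>)"
  \<comment> \<open>The coefficient of the basis monomial \<open>e\<close>, in units of $\lambda_2$.\<close>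
  define k where "k = (if e = (0, 5) then 1 else 3) * \<zeta>"
  have k0: "k \<noteq> 0" using \<zeta>0 by (simp add: k_def)
  define \<phi> :: "(nat \<Rightarrow> complex) \<Rightarrow> nat \<times> nat \<Rightarrow> complex" where
    "\<phi> l m = (if m = (1, 0) then l 3
              else if m = (1, 2) then \<i> * l 4 + 3 * (t * l 2)\<^sup>2
              else if m = (0, 3) then - (\<i> * \<zeta>) * l 1 + t * l 2 * (\<i> * l 4 + 3 * (t * l 2)\<^sup>2) - 2 * (t * l 2) ^ 3
              else if m = (0, 1) then - \<zeta> * l 0 + t * l 2 * l 3
              else k * l 2)" for l m
  \<comment> \<open>The shear recovered from the coefficient of the basis monomial \<open>e\<close>.\<close>
  define \<rho> where "\<rho> \<mu> = t * (\<mu> e / k)" for \<mu> :: "nat \<times> nat \<Rightarrow> complex"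
  define \<psi> :: "(nat \<times> nat \<Rightarrow> complex) \<Rightarrow> nat \<Rightarrow> complex" where
    "\<psi> \<mu> i = (if i = 3 then \<mu> (1, 0)
              else if i = 4 then (\<mu> (1, 2) - 3 * (\<rho> \<mu>)\<^sup>2) / \<i>
              else if i = 1 then (\<mu> (0, 3) - \<rho> \<mu> * \<mu> (1, 2) + 2 * (\<rho> \<mu>) ^ 3) / (- (\<i> * \<zeta>))
              else if i = 0 then (\<mu> (0, 1) - \<rho> \<mu> * \<mu> (1, 0)) / (- \<zeta>)
              else \<mu> e / k)" for \<mu> i
  have \<phi>: "\<phi> l (0, 1) = - \<zeta> * l 0 + t * l 2 * l 3"
    "\<phi> l (0, 3) = - (\<i> * \<zeta>) * l 1 + t * l 2 * (\<i> * l 4 + 3 * (t * l 2)\<^sup>2) - 2 * (t * l 2) ^ 3"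
    "\<phi> l (1, 0) = l 3" "\<phi> l (1, 2) = \<i> * l 4 + 3 * (t * l 2)\<^sup>2" for l
    unfolding \<phi>_def by simp_all
  have \<phi>e: "\<phi> l e = k * l 2" for l
    using e unfolding \<phi>_def by (elim disjE) simp_all
  note \<phi> = \<phi> \<phi>e
  have \<psi>: "\<psi> \<mu> 0 = (\<mu> (0, 1) - \<rho> \<mu> * \<mu> (1, 0)) / (- \<zeta>)"
    "\<psi> \<mu> 1 = (\<mu> (0, 3) - \<rho> \<mu> * \<mu> (1, 2) + 2 * (\<rho> \<mu>) ^ 3) / (- (\<i> * \<zeta>))"
    "\<psi> \<mu> 2 = \<mu> e / k" "\<psi> \<mu> 3 = \<mu> (1, 0)" "\<psi> \<mu> 4 = (\<mu> (1, 2) - 3 * (\<rho> \<mu>)\<^sup>2) / \<i>" for \<mu>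
    by (simp_all add: \<psi>_def)
  have five: "i = 0 \<or> i = 1 \<or> i = 2 \<or> i = 3 \<or> i = 4" if "i < tau (Type_II II5)" for i
    using that by auto
  show ?thesis
  proof (rule biholomorphic_pairs_by_coordinate_change[OF idx mon])
    show "\<phi> l m = \<phi> l' m" if "m \<in> odd_monomials B" "\<And>i. i < tau (Type_II II5) \<Longrightarrow> l i = l' i" for l l' :: "nat \<Rightarrow> complex" and m
      using that by (simp add: \<phi>_def)
    show "\<psi> \<mu> i = \<psi> \<mu>' i" if "i < tau (Type_II II5)" "\<And>m. m \<in> odd_monomials B \<Longrightarrow> \<mu> m = \<mu>' m" for \<mu> \<mu>' i
    proof -
      have "\<mu> (0, 1) = \<mu>' (0, 1)" "\<mu> (0, 3) = \<mu>' (0, 3)" "\<mu> (1, 0) = \<mu>' (1, 0)"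
        "\<mu> (1, 2) = \<mu>' (1, 2)" "\<mu> e = \<mu>' e"
        by (intro that(2), simp add: S)+
      then show ?thesis by (simp only: \<psi>_def \<rho>_def)
    qed
    show "\<psi> (\<phi> l) i = l i" if "i < tau (Type_II II5)" for l :: "nat \<Rightarrow> complex" and i
    proof -
      have \<rho>: "\<rho> (\<phi> l) = t * l 2" using k0 by (simp add: \<rho>_def \<phi>e)
      show ?thesis
        using five[OF that] by (elim disjE; simp only: \<psi> \<rho> \<phi>; use \<zeta>0 k0 in simp)
    qed
    show "\<phi> (\<psi> \<mu>) m = \<mu> m" if "m \<in> odd_monomials B" for \<mu> m
    proof -
      have \<rho>: "t * \<psi> \<mu> 2 = \<rho> \<mu>" unfolding \<rho>_def \<psi> ..
      have "m = (0, 1) \<or> m = (0, 3) \<or> m = (1, 0) \<or> m = (1, 2) \<or> m = e"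
        using that by (simp add: S)
      then show ?thesis
        by (elim disjE; simp only: \<phi> \<rho>; simp only: \<psi>; use \<zeta>0 k0 in simp)
    qed
    show "complex_diff_at (\<lambda>y. \<phi> (\<lambda>i. X i y) m) x"
      if "\<And>i. complex_diff_at (X i) x" for X m and x :: "complex^'n"
      unfolding \<phi>_def by (cases "m = (1, 0)"; cases "m = (1, 2)"; cases "m = (0, 3)"; cases "m = (0, 1)")
        (simp_all, (intro complex_diff_at_intros that)+)
    show "complex_diff_at (\<lambda>y. \<psi> (\<lambda>m. X m y) i) x"
      if "i < tau (Type_II II5)" "\<And>m. complex_diff_at (X m) x" for X i and x :: "complex^'m"
      using five[OF that(1)]
      by (elim disjE; simp only: \<psi> \<rho>_def; intro complex_diff_at_intros that(2))
    fix l :: "nat \<Rightarrow> complex"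
    let ?L = "\<lambda>u :: complex^2. vector [u $ 1 + t * l 2 * u $ 2, \<zeta> * u $ 2] :: complex^2"
    show "smooth_zero_level (odd_deformation (Type_II II5) (odd_monomials B) (\<phi> l)) \<longleftrightarrow>
        smooth_zero_level (curve_family (Type_II II5) l)"
    proof (rule odd_II_linear_change_smooth_iff[where L = ?L])
      show "bounded_linear ?L" "surj ?L" by (rule shear_scaling[OF \<zeta>0])+
      fix u :: "complex^2"
      define b c where "b = u $ 1" and "c = u $ 2"
      have sum: "(\<Sum>m\<in>odd_monomials B. \<phi> l m * monom2 m u) =
          \<phi> l (0, 1) * c + \<phi> l (0, 3) * c ^ 3 + \<phi> l (1, 0) * b + \<phi> l (1, 2) * (b * c\<^sup>2) + \<phi> l e * (b ^ fst e * c ^ snd e)"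
        unfolding S b_def c_def using e by (elim disjE) (simp_all add: monom2_def del: One_nat_def)
      have sq: "(\<zeta> * c)\<^sup>2 = \<i> * c\<^sup>2" using \<zeta>2 by (simp add: power2_eq_square)
      have sqsq: "(\<i> * c\<^sup>2)\<^sup>2 = - (c ^ 4)" by (simp add: power_mult_distrib flip: power_mult)
      have rhs: "odd_II (p_II II5 l) (q_II II5 l) (?L u) =
          (b + t * l 2 * c) ^ 3 + (b + t * l 2 * c) * (- (c ^ 4) + l 4 * (\<i> * c\<^sup>2) + l 3)
          - \<zeta> * c * (l 2 * - (c ^ 4) + l 1 * (\<i> * c\<^sup>2) + l 0)"
        unfolding odd_II_def vector_2 p_II.simps q_II.simps by (simp only: sq sqsq flip: b_def c_def)
      have lhs: "odd_deformation (Type_II II5) (odd_monomials B) (\<phi> l) u = b ^ 3 - b * c ^ 4 +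
          (\<phi> l (0, 1) * c + \<phi> l (0, 3) * c ^ 3 + \<phi> l (1, 0) * b + \<phi> l (1, 2) * (b * c\<^sup>2) + \<phi> l e * (b ^ fst e * c ^ snd e))"
        unfolding odd_deformation_def sum by (simp add: b_def c_def Let_def)
      show "odd_deformation (Type_II II5) (odd_monomials B) (\<phi> l) u = odd_II (p_II II5 l) (q_II II5 l) (?L u)"
        using e
      proof
        assume e1: "e = (0, 5)"
        then have "t = 0" "k = \<zeta>" by (simp_all add: t_def k_def)
        then show ?thesis
          unfolding lhs rhs \<phi> unfolding e1 fst_conv snd_conv by algebra
      next
        assume e2: "e = (2, 1)"
        then have "t = \<zeta>" "k = 3 * \<zeta>" by (simp_all add: t_def k_def)
        then show ?thesis
          unfolding lhs rhs \<phi> unfolding e2 fst_conv snd_conv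
          by (simp add: algebra_simps power2_eq_square power3_eq_cube power4_eq_xxxx)
      qed
    qed
  qed
qed

theorem proposition6p7:
  fixes T :: triplet
    and idx :: "nat \<Rightarrow> 'n::finite"
    and B :: "(nat \<times> nat) set"
    and mon :: "'m::finite \<Rightarrow> nat \<times> nat"
  assumes "\<And>k. T = Type_I k \<Longrightarrow> k \<ge> 1"
    and "bij_betw idx {..<tau T} UNIV"
    and "monomial_R_miniversal (odd_function T) B"
    and "bij_betw mon UNIV (odd_monomials B)"
  shows "biholomorphic_pairs (matrix_bifurcation T idx) (odd_bifurcation T mon) \<and>
         biholomorphic_pairs (odd_bifurcation T mon) (curve_bifurcation T idx)"
proof -
  have "biholomorphic_pairs (curve_bifurcation T idx) (odd_bifurcation T mon)"
  proof (cases T)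
    case (Type_I k)
    then show ?thesis using curve_odd_pairs_type_I assms by blast
  next
    case (Type_II s)
    show ?thesis
    proof (cases s)
      case II4
      show ?thesis
        using assms(2-4) unfolding Type_II II4 by (rule curve_odd_pairs_type_II_cusp[of _ 2, rotated]) simp
    next
      case II5
      show ?thesis
        using assms(2-4) unfolding Type_II II5 by (rule curve_odd_pairs_type_II5)
    next
      case II6
      show ?thesis
        using assms(2-4) unfolding Type_II II6 by (rule curve_odd_pairs_type_II_cusp[of _ 3, rotated]) simp
    qed
  qed
  then show ?thesis
    unfolding matrix_bifurcation_eq_curve_bifurcation using biholomorphic_pairs_sym by blast
qed

end
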